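(* Consider the nonlinear parabolic system $$\partial_tu+\sum_{j=1}^d\partial_{x_j}F_j(u)=\sum_{j=1}^d\partial_{x_j}^2B(u),\qquad u(x,t)\in\Omega_u\subset\mathbb R^K,\ x\in\mathbb R^d,$$ with smooth $F_j,B:\Omega_u\to\mathbb R^K$ such that (B1) for all $\xi\in\mathbb R^d$, $\sum_j\xi_j\partial_uF_j(u)$ has real eigenvalues and is diagonalizable; (B2) the eigenvalues of $\partial_uB(u)$ are positive. Consider the diffusive kinetic model (with small parameter written as $\varepsilon^2$) $$\begin{aligned} &\partial_tf_l+\sum_{j=1}^d\lambda_{lj}\partial_{x_j}f_l=\frac1{\varepsilon^2}\big(M_l(u)-f_l\big),\quad1\le l\le N, \\ &\partial_tf_{N+m}+\sum_{j=1}^d\gamma^\varepsilon\sigma_{mj}\partial_{x_j}f_{N+m}=\frac1{\varepsilon^2}\Big(\frac{B(u)}{N'\theta^2}-f_{N+m}\Big),\quad1\le m\le N',\end{aligned}$$ with $u=\sum_{l=1}^{N+N'}f_l$, $f_l\in\mathbb R^K$, constants $\lambda_{lj}\in\mathbb R$, $\mu\ge0$, $\theta>0$, $N'\ge d+1$, $\gamma^\varepsilon=\mu+\theta\sqrt{N'}/\varepsilon$, constants $\sigma_{mj}$ satisfying $\sum_{m=1}^{N'}\sigma_{mj}=0$ and $\sum_{m=1}^{N'}\sigma_{mj}\sigma_{mi}=\delta_{ij}$ for $i,j=1,\dots,d$, and smooth $M_l:\Omega_u\to\mathbb R^K$ satisfying $$\sum_{l=1}^NM_l(u)=u-\frac{B(u)}{\theta^2},\qquad\sum_{l=1}^N\lambda_{lj}M_l(u)=F_j(u),\quad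 j=1,\dots,d.$$ Assume further that (C1) the eigenvalues of $\partial_uM_l(u)$ are positive for all $u\in\Omega_u$ and $1\le l\le N$; (C2) for any $\xi\in\mathbb R^d$ with $|\xi|=1$ and all $u\in\Omega_u$ there is a basis of common eigenvectors for the matrices $\sum_j\xi_j\partial_uF_j(u)$, $\partial_uM_l(u)$ ($l=1,\dots,N$) and $\partial_uB(u)$. Then the model, rewritten as a first-order quasilinear system for $U=(u,w)$ with $w=(g_2,\dots,g_{N+N'})$, where $g_l=f_l-M_l(u)$ for $l\le N$ and $g_{N+m}=f_{N+m}-\frac{B(u)}{N'\theta^2}$ (see context), satisfies the convergence criteria (i)-(v) listed in the context, and its limit equation (as defined in the context) is the parabolic system above.
   Context: Rewritten kinetic system. Put $M_{N+m}(u)=\frac{B(u)}{N'\theta^2}$ for $1\le m\le N'$; then $\sum_{l=1}^{N+N'}g_l=0$. Let $P=P(u)$ be the $K(N+N')\times K(N+N')$ matrix of $K\times K$ blocks whose first block row is $(I_K,\dots,I_K)$ and whose $(l,i)$ block for $l=2,\dots,N+N'$ is $\delta_{li}I_K-\partial_uM_l(u)$ (it is invertible). Let $\tilde A_j=\mathrm{diag}\{\varepsilon\lambda_{1j}I_K,\dots,\varepsilon\lambda_{Nj}I_K,\ \sigma_{1j}(\varepsilon\mu+\theta\sqrt{N'})I_K,\dots,\sigma_{N'j}(\varepsilon\mu+\theta\sqrt{N'})I_K\}$. The system for $U=(u,w)$ is $\partial_tU+\frac1\varepsilon\sum_{j=1}^dA_j(U;\varepsilon)\partial_{x_j}U=\frac1{\varepsilon^2}Q(U)$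 with $A_j=P\tilde A_jP^{-1}$ and $Q(U)=-(0,w)^T$; here $n=K(N+N')$, $r=K(N+N'-1)$. Convergence criteria. Let $\partial_tU+\frac1\varepsilon\sum_{j=1}^dA_j(U;\varepsilon)\partial_{x_j}U=\frac1{\varepsilon^2}Q(U;\varepsilon)$ be a first-order system for $U=(u,w)^T\in\Omega\subset\mathbb R^n$, $u\in\mathbb R^{n-r}$, $w\in\mathbb R^r$, with parameter $\varepsilon\in(0,1]$; $A_j$ and $Q$ are smooth in $(U;\varepsilon)$, up to $\varepsilon=0$. $\Omega_u\subset\mathbb R^{n-r}$ is an open convex set (the state space of $u$), $\Omega$ is open, $(u,w)\in\Omega$ implies $u\in\Omega_u$, and $(u,0)\in\Omega$ for $u\in\Omega_u$. An $n\times n$ matrix $A$ is partitioned as $\begin{pmatrix} A^{11} & A^{12} \\ A^{21} & A^{22} \end{pmatrix}$ according to $n=(n-r)+r$. The criteria are: (i) $Q(U;\varepsilon)=(0,q(U;\varepsilon))^T$ with $q$ a smooth $\mathbb R^r$-valued function. (ii) $q(u,w;0)=0$ if and only if $w=0$, and $\partial_wq(u,0;0)$ is invertible for all $u\in\Omega_u$. (iii) There is a symmetric positive definite matrix $A_0(U;\varepsilon)$ (symmetrizer) such that $A_0(U;\varepsilon)A_j(U;\varepsilon)=A_j(U;\varepsilon)^TA_0(U;\varepsilon)$ for all $U\in\Omega$ and all $j$. (iv) With this $A_0$, there is a symmetric positive definite $r\times r$ matrix $S(u)$ such that $A_0(u,0;0)\,\partial_UQ(u,0;0)+(\partial_UQ(u,0;0))^TA_0(u,0;0)\le-\begin{pmatrix}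 0 & 0 \\ 0 & S(u) \end{pmatrix}$ for all $u\in\Omega_u$. (v) $A_j^{11}(u,0;0)=0$ and $\partial_uA_j^{11}(u,0;0)=0$ for all $u\in\Omega_u$ and all $j$. Limit equation. This is the equation for the leading term $u_0$ in the formal expansion $u\sim u_0+\varepsilon u_1+\cdots$, $w\sim w_0+\varepsilon w_1+\cdots$; explicitly $w_0=0$, $w_1=\partial_wq(u_0,0;0)^{-1}\big[\sum_jA_j^{21}(u_0,0;0)\partial_{x_j}u_0-\partial_\varepsilon q(u_0,0;0)\big]$ and $$\partial_tu_0+\sum_jA_j^{12}(u_0,0;0)\partial_{x_j}w_1+\sum_j\big(\partial_wA_j^{11}(u_0,0;0)[w_1]\big)\partial_{x_j}u_0+\sum_j\partial_\varepsilon A_j^{11}(u_0,0;0)\partial_{x_j}u_0=0.$$ *)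

theory Defs
  imports "HOL-Analysis.Analysis"
begin

section \<open>Smoothness\<close>

text \<open>\<^term>\<open>Ck_on n f S\<close> is meant for open \<open>S\<close> only. Sets that are not open, such as
  \<open>\<Omega> \<times> [0,1]\<close> (smoothness up to \<open>\<epsilon> = 0\<close>), are covered by \<open>smooth_on\<close>, which asks for a smooth
  extension to an open neighbourhood.\<close>

primrec Ck_on :: "nat \<Rightarrow> ('a::euclidean_space \<Rightarrow> 'b::real_normed_vector) \<Rightarrow> 'a set \<Rightarrow> bool" where
  "Ck_on 0 f S \<longleftrightarrow> continuous_on S f"
| "Ck_on (Suc n) f S \<longleftrightarrow>
     f differentiable_on S \<and> (\<forall>b\<in>Basis. Ck_on n (\<lambda>x. frechet_derivative f (at x) b) S)"

definition smooth_on :: "'a::euclidean_space set \<Rightarrow> ('a \<Rightarrow> 'b::real_normed_vector) \<Rightarrow> bool" where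
  "smooth_on S f \<longleftrightarrow>
     (\<exists>T g. open T \<and> S \<subseteq> T \<and> (\<forall>n. Ck_on n g T) \<and> (\<forall>x\<in>S. g x = f x))"


section \<open>Matrices\<close>

text \<open>Eigenvalues of a real matrix are taken over the complex numbers, so that having real or
  positive eigenvalues excludes non-real ones.\<close>

definition complex_eigenvalue :: "real^'n^'n \<Rightarrow> complex \<Rightarrow> bool" where
  "complex_eigenvalue A z \<longleftrightarrow>
     (\<exists>v::complex^'n. v \<noteq> 0 \<and> map_matrix complex_of_real A *v v = z *s v)"

definition real_eigenvalues :: "real^'n^'n \<Rightarrow> bool" where
  "real_eigenvalues A \<longleftrightarrow> (\<forall>z. complex_eigenvalue A z \<longrightarrow> z \<in> \<real>)"

definition positive_eigenvalues :: "real^'n^'n \<Rightarrow> bool" where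
  "positive_eigenvalues A \<longleftrightarrow> (\<forall>z. complex_eigenvalue A z \<longrightarrow> z \<in> \<real> \<and> Re z > 0)"

definition diagonalizable :: "real^'n^'n \<Rightarrow> bool" where
  "diagonalizable A \<longleftrightarrow>
     (\<exists>(R::real^'n^'n) D. invertible R \<and> (\<forall>i j. i \<noteq> j \<longrightarrow> D $ i $ j = 0) \<and> A = R ** D ** matrix_inv R)"

definition eigenvector :: "real^'n^'n \<Rightarrow> real^'n \<Rightarrow> bool" where
  "eigenvector A v \<longleftrightarrow> v \<noteq> 0 \<and> (\<exists>c. A *v v = c *\<^sub>R v)"

definition common_eigenbasis :: "(real^'n^'n) set \<Rightarrow> bool" where
  "common_eigenbasis \<A> \<longleftrightarrow>
     (\<exists>b. independent b \<and> span b = UNIV \<and> (\<forall>v\<in>b. \<forall>A\<in>\<A>. eigenvector A v))"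

definition sym_pos_def :: "real^'n^'n \<Rightarrow> bool" where
  "sym_pos_def A \<longleftrightarrow> transpose A = A \<and> (\<forall>v. v \<noteq> 0 \<longrightarrow> v \<bullet> (A *v v) > 0)"

text \<open>The Loewner order, used for symmetric matrices.\<close>

definition matrix_le :: "real^'n^'n \<Rightarrow> real^'n^'n \<Rightarrow> bool" where
  "matrix_le A B \<longleftrightarrow> (\<forall>v. v \<bullet> (A *v v) \<le> v \<bullet> (B *v v))"


section \<open>First-order systems for U = (u,w)\<close>

text \<open>The index type of \<open>U\<close> is a sum type: \<open>Inl\<close> marks the components of \<open>u\<close> (there are
  \<open>n - r\<close> of them) and \<open>Inr\<close> those of \<open>w\<close> (there are \<open>r\<close>).\<close>

definition state :: "real^'p \<Rightarrow> real^'q \<Rightarrow> real^('p::finite + 'q::finite)" where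
  "state u w = (\<chi> i. case i of Inl a \<Rightarrow> u $ a | Inr b \<Rightarrow> w $ b)"

definition upart :: "real^('p::finite + 'q::finite) \<Rightarrow> real^'p" where
  "upart U = (\<chi> a. U $ Inl a)"

definition wpart :: "real^('p::finite + 'q::finite) \<Rightarrow> real^'q" where
  "wpart U = (\<chi> b. U $ Inr b)"

definition block11 :: "real^('p::finite + 'q::finite)^('p + 'q) \<Rightarrow> real^'p^'p" where
  "block11 A = (\<chi> i j. A $ Inl i $ Inl j)"

definition block12 :: "real^('p::finite + 'q::finite)^('p + 'q) \<Rightarrow> real^'q^'p" where
  "block12 A = (\<chi> i j. A $ Inl i $ Inr j)"

definition block21 :: "real^('p::finite + 'q::finite)^('p + 'q) \<Rightarrow> real^'p^'q" where
  "block21 A = (\<chi> i j. A $ Inr i $ Inl j)"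

definition lower_block :: "real^'q^'q \<Rightarrow> real^('p::finite + 'q::finite)^('p + 'q)" where
  "lower_block S = (\<chi> i j. case (i, j) of (Inr a, Inr b) \<Rightarrow> S $ a $ b | _ \<Rightarrow> 0)"

definition dx :: "'d \<Rightarrow> ((real^'d) \<times> real \<Rightarrow> 'b::real_normed_vector) \<Rightarrow> (real^'d) \<times> real \<Rightarrow> 'b" where
  "dx j h z = vector_derivative (\<lambda>s. h (fst z + s *\<^sub>R axis j 1, snd z)) (at 0)"

definition dt :: "((real^'d) \<times> real \<Rightarrow> 'b::real_normed_vector) \<Rightarrow> (real^'d) \<times> real \<Rightarrow> 'b" where
  "dt h z = vector_derivative (\<lambda>s. h (fst z, s)) (at (snd z))"

definition first_order_equation ::
  "('d::finite \<Rightarrow> real^('p::finite + 'q::finite) \<Rightarrow> real \<Rightarrow> real^('p + 'q)^('p + 'q)) \<Rightarrow>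
   (real^('p + 'q) \<Rightarrow> real \<Rightarrow> real^('p + 'q)) \<Rightarrow>
   real \<Rightarrow> ((real^'d) \<times> real \<Rightarrow> real^('p + 'q)) \<Rightarrow> (real^'d) \<times> real \<Rightarrow> bool" where
  "first_order_equation A Q \<epsilon> U z \<longleftrightarrow>
     dt U z + (1 / \<epsilon>) *\<^sub>R (\<Sum>j\<in>UNIV. A j (U z) \<epsilon> *v dx j U z) = (1 / \<epsilon>\<^sup>2) *\<^sub>R Q (U z) \<epsilon>"

definition state_spaces :: "(real^'p) set \<Rightarrow> (real^('p::finite + 'q::finite)) set \<Rightarrow> bool" where
  "state_spaces \<Omega>u \<Omega> \<longleftrightarrow>
     open \<Omega>u \<and> convex \<Omega>u \<and> open \<Omega> \<and>
     (\<forall>u w. state u w \<in> \<Omega> \<longrightarrow> u \<in> \<Omega>u) \<and> (\<forall>u\<in>\<Omega>u. state u 0 \<in> \<Omega>)"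

definition smooth_coefficients ::
  "(real^('p::finite + 'q::finite)) set \<Rightarrow>
   ('d \<Rightarrow> real^('p + 'q) \<Rightarrow> real \<Rightarrow> real^('p + 'q)^('p + 'q)) \<Rightarrow>
   (real^('p + 'q) \<Rightarrow> real \<Rightarrow> real^('p + 'q)) \<Rightarrow> bool" where
  "smooth_coefficients \<Omega> A Q \<longleftrightarrow>
     (\<forall>j. smooth_on (\<Omega> \<times> {0..1}) (\<lambda>(U, \<epsilon>). A j U \<epsilon>)) \<and>
     smooth_on (\<Omega> \<times> {0..1}) (\<lambda>(U, \<epsilon>). Q U \<epsilon>)"


subsection \<open>The convergence criteria\<close>

definition criterion_i ::
  "(real^('p::finite + 'q::finite)) set \<Rightarrow> (real^('p + 'q) \<Rightarrow> real \<Rightarrow> real^('p + 'q)) \<Rightarrow> bool" where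
  "criterion_i \<Omega> Q \<longleftrightarrow>
     (\<forall>U\<in>\<Omega>. \<forall>\<epsilon>\<in>{0..1}. upart (Q U \<epsilon>) = 0) \<and>
     smooth_on (\<Omega> \<times> {0..1}) (\<lambda>(U, \<epsilon>). wpart (Q U \<epsilon>))"

definition dq_dw :: "(real^('p::finite + 'q::finite) \<Rightarrow> real \<Rightarrow> real^('p + 'q)) \<Rightarrow> real^'p \<Rightarrow> real^'q^'q" where
  "dq_dw Q u = jacobian (\<lambda>w. wpart (Q (state u w) 0)) (at 0)"

definition criterion_ii ::
  "(real^'p) set \<Rightarrow> (real^('p::finite + 'q::finite)) set \<Rightarrow>
   (real^('p + 'q) \<Rightarrow> real \<Rightarrow> real^('p + 'q)) \<Rightarrow> bool" where
  "criterion_ii \<Omega>u \<Omega> Q \<longleftrightarrow>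
     (\<forall>u w. state u w \<in> \<Omega> \<longrightarrow> (wpart (Q (state u w) 0) = 0 \<longleftrightarrow> w = 0)) \<and>
     (\<forall>u\<in>\<Omega>u. invertible (dq_dw Q u))"

text \<open>The symmetrizer is not required to depend smoothly on its arguments.\<close>

definition criterion_iii ::
  "(real^('p::finite + 'q::finite)) set \<Rightarrow>
   ('d \<Rightarrow> real^('p + 'q) \<Rightarrow> real \<Rightarrow> real^('p + 'q)^('p + 'q)) \<Rightarrow>
   (real^('p + 'q) \<Rightarrow> real \<Rightarrow> real^('p + 'q)^('p + 'q)) \<Rightarrow> bool" where
  "criterion_iii \<Omega> A A0 \<longleftrightarrow>
     (\<forall>U\<in>\<Omega>. \<forall>\<epsilon>\<in>{0..1}. sym_pos_def (A0 U \<epsilon>) \<and>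
        (\<forall>j. A0 U \<epsilon> ** A j U \<epsilon> = transpose (A j U \<epsilon>) ** A0 U \<epsilon>))"

definition criterion_iv ::
  "(real^'p) set \<Rightarrow> (real^('p::finite + 'q::finite) \<Rightarrow> real \<Rightarrow> real^('p + 'q)) \<Rightarrow>
   (real^('p + 'q) \<Rightarrow> real \<Rightarrow> real^('p + 'q)^('p + 'q)) \<Rightarrow> bool" where
  "criterion_iv \<Omega>u Q A0 \<longleftrightarrow>
     (\<exists>S :: real^'p \<Rightarrow> real^'q^'q. \<forall>u\<in>\<Omega>u. sym_pos_def (S u) \<and>
        (let DQ = jacobian (\<lambda>U. Q U 0) (at (state u 0)); H = A0 (state u 0) 0 in
         matrix_le (H ** DQ + transpose DQ ** H) (- lower_block (S u))))"

definition criterion_v ::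
  "(real^'p) set \<Rightarrow>
   ('d \<Rightarrow> real^('p::finite + 'q::finite) \<Rightarrow> real \<Rightarrow> real^('p + 'q)^('p + 'q)) \<Rightarrow> bool" where
  "criterion_v \<Omega>u A \<longleftrightarrow>
     (\<forall>u\<in>\<Omega>u. \<forall>j. block11 (A j (state u 0) 0) = 0 \<and>
        ((\<lambda>u'. block11 (A j (state u' 0) 0)) has_derivative (\<lambda>_. 0)) (at u))"

definition convergence_criteria ::
  "(real^'p) set \<Rightarrow> (real^('p::finite + 'q::finite)) set \<Rightarrow>
   ('d \<Rightarrow> real^('p + 'q) \<Rightarrow> real \<Rightarrow> real^('p + 'q)^('p + 'q)) \<Rightarrow>
   (real^('p + 'q) \<Rightarrow> real \<Rightarrow> real^('p + 'q)) \<Rightarrow> bool" where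
  "convergence_criteria \<Omega>u \<Omega> A Q \<longleftrightarrow>
     state_spaces \<Omega>u \<Omega> \<and> smooth_coefficients \<Omega> A Q \<and>
     criterion_i \<Omega> Q \<and>
     criterion_ii \<Omega>u \<Omega> Q \<and>
     (\<exists>A0. criterion_iii \<Omega> A A0 \<and> criterion_iv \<Omega>u Q A0) \<and>
     criterion_v \<Omega>u A"


subsection \<open>The limit equation\<close>

text \<open>The parameter lives in \<open>[0,1]\<close>, so \<open>\<epsilon>\<close>-derivatives at \<open>0\<close> are taken within \<open>[0,1]\<close>.\<close>

definition limit_w1 ::
  "('d::finite \<Rightarrow> real^('p::finite + 'q::finite) \<Rightarrow> real \<Rightarrow> real^('p + 'q)^('p + 'q)) \<Rightarrow>
   (real^('p + 'q) \<Rightarrow> real \<Rightarrow> real^('p + 'q)) \<Rightarrow>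
   ((real^'d) \<times> real \<Rightarrow> real^'p) \<Rightarrow> (real^'d) \<times> real \<Rightarrow> real^'q" where
  "limit_w1 A Q u z =
     matrix_inv (dq_dw Q (u z)) *v
       ((\<Sum>j\<in>UNIV. block21 (A j (state (u z) 0) 0) *v dx j u z)
        - vector_derivative (\<lambda>\<epsilon>. wpart (Q (state (u z) 0) \<epsilon>)) (at 0 within {0..1}))"

definition limit_equation ::
  "('d::finite \<Rightarrow> real^('p::finite + 'q::finite) \<Rightarrow> real \<Rightarrow> real^('p + 'q)^('p + 'q)) \<Rightarrow>
   (real^('p + 'q) \<Rightarrow> real \<Rightarrow> real^('p + 'q)) \<Rightarrow>
   ((real^'d) \<times> real \<Rightarrow> real^'p) \<Rightarrow> (real^'d) \<times> real \<Rightarrow> bool" where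
  "limit_equation A Q u z \<longleftrightarrow>
     dt u z
     + (\<Sum>j\<in>UNIV. block12 (A j (state (u z) 0) 0) *v dx j (limit_w1 A Q u) z)
     + (\<Sum>j\<in>UNIV. frechet_derivative (\<lambda>w. block11 (A j (state (u z) w) 0)) (at 0)
                      (limit_w1 A Q u z) *v dx j u z)
     + (\<Sum>j\<in>UNIV. vector_derivative (\<lambda>\<epsilon>. block11 (A j (state (u z) 0) \<epsilon>))
                      (at 0 within {0..1}) *v dx j u z) = 0"


section \<open>The parabolic system and the kinetic model\<close>

definition parabolic_equation ::
  "('d::finite \<Rightarrow> real^'k \<Rightarrow> real^'k) \<Rightarrow> (real^'k \<Rightarrow> real^'k) \<Rightarrow>
   ((real^'d) \<times> real \<Rightarrow> real^'k) \<Rightarrow> (real^'d) \<times> real \<Rightarrow> bool" where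
  "parabolic_equation F B u z \<longleftrightarrow>
     dt u z + (\<Sum>j\<in>UNIV. dx j (\<lambda>y. F j (u y)) z)
       = (\<Sum>j\<in>UNIV. dx j (dx j (\<lambda>y. B (u y))) z)"

text \<open>Regularity under which both second-order equations make sense classically. Only
  continuity in \<open>x\<close> is asked of the space derivatives, so this contains the usual class
  of functions that are \<open>C\<^sup>2\<close> in \<open>x\<close> and \<open>C\<^sup>1\<close> in \<open>t\<close>.\<close>

definition C21_on ::
  "((real^'d) \<times> real) set \<Rightarrow> ((real^'d) \<times> real \<Rightarrow> real^'k) \<Rightarrow> bool" where
  "C21_on D u \<longleftrightarrow>
     (\<forall>t. Ck_on 2 (\<lambda>x. u (x, t)) {x. (x, t) \<in> D}) \<and>
     (\<forall>(x, t)\<in>D. (\<lambda>s. u (x, s)) differentiable (at t))"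

definition kinetic_model ::
  "nat \<Rightarrow> nat \<Rightarrow> (nat \<Rightarrow> 'd::finite \<Rightarrow> real) \<Rightarrow> (nat \<Rightarrow> 'd \<Rightarrow> real) \<Rightarrow> real \<Rightarrow> real \<Rightarrow>
   (real^'k \<Rightarrow> real^'k) \<Rightarrow> (nat \<Rightarrow> real^'k \<Rightarrow> real^'k) \<Rightarrow> real \<Rightarrow>
   (nat \<Rightarrow> (real^'d) \<times> real \<Rightarrow> real^'k) \<Rightarrow> (real^'d) \<times> real \<Rightarrow> bool" where
  "kinetic_model N N' lam \<sigma> \<mu> \<theta> B M \<epsilon> f z \<longleftrightarrow>
     (let u = (\<Sum>l=1..N + N'. f l z); \<gamma> = \<mu> + \<theta> * sqrt (real N') / \<epsilon> in
      (\<forall>l\<in>{1..N}.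
         dt (f l) z + (\<Sum>j\<in>UNIV. lam l j *\<^sub>R dx j (f l) z)
           = (1 / \<epsilon>\<^sup>2) *\<^sub>R (M l u - f l z)) \<and>
      (\<forall>m\<in>{1..N'}.
         dt (f (N + m)) z + (\<Sum>j\<in>UNIV. (\<gamma> * \<sigma> m j) *\<^sub>R dx j (f (N + m)) z)
           = (1 / \<epsilon>\<^sup>2) *\<^sub>R ((1 / (real N' * \<theta>\<^sup>2)) *\<^sub>R B u - f (N + m) z)))"


subsection \<open>Rewriting in the variables U = (u,w)\<close>

definition maxwellian ::
  "nat \<Rightarrow> nat \<Rightarrow> real \<Rightarrow> (real^'k \<Rightarrow> real^'k) \<Rightarrow> (nat \<Rightarrow> real^'k \<Rightarrow> real^'k) \<Rightarrow>
   nat \<Rightarrow> real^'k \<Rightarrow> real^'k" where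
  "maxwellian N N' \<theta> B M l u = (if l \<le> N then M l u else (1 / (real N' * \<theta>\<^sup>2)) *\<^sub>R B u)"

text \<open>The blocks \<open>l = 2, \<dots>, N + N'\<close> are labelled by a finite type through a bijection
  \<open>e\<close> from that type onto \<open>{2..N + N'}\<close>. A component of \<open>U\<close>, and a row or column
  of the matrices below, has a block number and a position inside its block.\<close>

definition block_no :: "('r \<Rightarrow> nat) \<Rightarrow> 'k + 'r \<times> 'k \<Rightarrow> nat" where
  "block_no e i = (case i of Inl _ \<Rightarrow> 1 | Inr (r, _) \<Rightarrow> e r)"

definition block_pos :: "'k + 'r \<times> 'k \<Rightarrow> 'k" where
  "block_pos i = (case i of Inl k \<Rightarrow> k | Inr (_, k) \<Rightarrow> k)"

definition kinetic_U ::
  "nat \<Rightarrow> nat \<Rightarrow> real \<Rightarrow> (real^'k \<Rightarrow> real^'k) \<Rightarrow> (nat \<Rightarrow> real^'k \<Rightarrow> real^'k) \<Rightarrow>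
   ('r::finite \<Rightarrow> nat) \<Rightarrow> (nat \<Rightarrow> real^'k) \<Rightarrow> real^('k + 'r \<times> 'k)" where
  "kinetic_U N N' \<theta> B M e f =
     (let u = (\<Sum>l=1..N + N'. f l) in
      state u (\<chi> i. (f (e (fst i)) - maxwellian N N' \<theta> B M (e (fst i)) u) $ snd i))"

definition kinetic_P ::
  "nat \<Rightarrow> nat \<Rightarrow> real \<Rightarrow> (real^'k \<Rightarrow> real^'k) \<Rightarrow> (nat \<Rightarrow> real^'k \<Rightarrow> real^'k) \<Rightarrow>
   ('r::finite \<Rightarrow> nat) \<Rightarrow> real^'k \<Rightarrow> real^('k + 'r \<times> 'k)^('k + 'r \<times> 'k)" where
  "kinetic_P N N' \<theta> B M e u =
     (\<chi> i j. let l = block_no e i; I = (mat 1 :: real^'k^'k) in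
        (if l = 1 then I
         else (if l = block_no e j then I else 0) - jacobian (maxwellian N N' \<theta> B M l) (at u))
          $ block_pos i $ block_pos j)"

definition kinetic_At ::
  "nat \<Rightarrow> nat \<Rightarrow> (nat \<Rightarrow> 'd \<Rightarrow> real) \<Rightarrow> (nat \<Rightarrow> 'd \<Rightarrow> real) \<Rightarrow> real \<Rightarrow> real \<Rightarrow>
   ('r::finite \<Rightarrow> nat) \<Rightarrow> 'd \<Rightarrow> real \<Rightarrow> real^('k::finite + 'r \<times> 'k)^('k + 'r \<times> 'k)" where
  "kinetic_At N N' lam \<sigma> \<mu> \<theta> e j \<epsilon> =
     (\<chi> i i'. if i = i' then
        (let l = block_no e i in
         if l \<le> N then \<epsilon> * lam l j else \<sigma> (l - N) j * (\<epsilon> * \<mu> + \<theta> * sqrt (real N')))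
      else 0)"

definition kinetic_A ::
  "nat \<Rightarrow> nat \<Rightarrow> (nat \<Rightarrow> 'd \<Rightarrow> real) \<Rightarrow> (nat \<Rightarrow> 'd \<Rightarrow> real) \<Rightarrow> real \<Rightarrow> real \<Rightarrow>
   (real^'k \<Rightarrow> real^'k) \<Rightarrow> (nat \<Rightarrow> real^'k \<Rightarrow> real^'k) \<Rightarrow> ('r::finite \<Rightarrow> nat) \<Rightarrow>
   'd \<Rightarrow> real^('k + 'r \<times> 'k) \<Rightarrow> real \<Rightarrow> real^('k + 'r \<times> 'k)^('k + 'r \<times> 'k)" where
  "kinetic_A N N' lam \<sigma> \<mu> \<theta> B M e j U \<epsilon> =
     (let P = kinetic_P N N' \<theta> B M e (upart U) in
      P ** kinetic_At N N' lam \<sigma> \<mu> \<theta> e j \<epsilon> ** matrix_inv P)"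

definition kinetic_Q :: "real^('k::finite + 'r::finite \<times> 'k) \<Rightarrow> real \<Rightarrow> real^('k + 'r \<times> 'k)" where
  "kinetic_Q U \<epsilon> = - state 0 (wpart U)"

end

theory Submission
  imports Defs
begin

text \<open>
  Written blockwise, \<open>P\<close> sends \<open>(\<phi>\<^sub>1, \<phi>\<^sub>2, \<dots>)\<close> to \<open>(s, \<phi>\<^sub>l - J\<^sub>l s)\<close> with \<open>s = \<Sum>\<^sub>l \<phi>\<^sub>l\<close>, where \<open>J\<^sub>l\<close> is the
  derivative of the \<open>l\<close>-th Maxwellian. Since \<open>\<Sum>\<^sub>l J\<^sub>l = I\<close>, its inverse is explicit and polynomial in the
  \<open>J\<^sub>l\<close>; every block of \<open>A\<^sub>j\<close> can be read off, for instance \<open>A\<^sub>j\<^sup>1\<^sup>1 = \<epsilon> F\<^sub>j'(u)\<close>.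

  The symmetrizer is \<open>P\<^sup>-\<^sup>T diag(D\<^sub>l) P\<^sup>-\<^sup>1\<close>. It symmetrizes every \<open>A\<^sub>j\<close> because the blocks of
  \<open>diag(D\<^sub>l)\<close> commute with scalar ones. In a common eigenbasis \<open>R\<close> of the \<open>J\<^sub>l = R \<Lambda>\<^sub>l R\<^sup>-\<^sup>1\<close> the choice
  \<open>D\<^sub>l = R\<^sup>-\<^sup>T \<Lambda>\<^sub>l\<^sup>-\<^sup>1 R\<^sup>-\<^sup>1\<close> makes \<open>D\<^sub>l J\<^sub>l\<close> independent of \<open>l\<close>, and this is exactly what decouples \<open>u\<close>
  from \<open>w\<close> in the damping criterion (iv). In the limit equation, orthonormality of the \<open>\<sigma>\<^sub>m\<^sub>j\<close> reduces the
  second-order terms to \<open>\<partial>\<^sub>j\<partial>\<^sub>j B(u)\<close>.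
\<close>

section \<open>Block vectors\<close>

text \<open>Identifies the space of \<open>U\<close> with tuples of \<open>K\<close>-vectors
  numbered by blocks, so that matrix computations run over block numbers instead of the sum-type
  index.\<close>

definition stack :: "('r::finite \<Rightarrow> nat) \<Rightarrow> (nat \<Rightarrow> real^'k) \<Rightarrow> real^('k + 'r \<times> 'k)" where
  "stack e \<phi> = (\<chi> i. \<phi> (block_no e i) $ block_pos i)"

text \<open>Inverse of \<open>stack\<close> once \<open>e\<close> is a bijection onto
  \<open>{2..L}\<close>. Values at other block numbers are arbitrary, since \<open>inv e\<close> is
  unspecified there; \<open>stack\<close> never reads them.\<close>

definition unstack :: "('r::finite \<Rightarrow> nat) \<Rightarrow> real^('k + 'r \<times> 'k) \<Rightarrow> nat \<Rightarrow> real^'k" where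
  "unstack e U l = (\<chi> k. if l = 1 then U $ Inl k else U $ Inr (inv e l, k))"

lemma sum_sum_type:
  fixes h :: "'k::finite + 'r::finite \<times> 'k \<Rightarrow> 'a::comm_monoid_add"
  shows "(\<Sum>i\<in>UNIV. h i) = (\<Sum>k\<in>UNIV. h (Inl k)) + (\<Sum>r\<in>UNIV. \<Sum>k\<in>UNIV. h (Inr (r, k)))"
  by (simp add: UNIV_Plus_UNIV[symmetric] sum.Plus UNIV_Times_UNIV[symmetric] sum.cartesian_product
      del: UNIV_Plus_UNIV UNIV_Times_UNIV)

lemma upart_stack [simp]: "upart (stack e \<phi>) = \<phi> 1"
  by (simp add: vec_eq_iff upart_def stack_def block_no_def block_pos_def)

lemma wpart_stack [simp]: "wpart (stack e \<phi>) $ i = \<phi> (e (fst i)) $ snd i"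
  by (simp add: wpart_def stack_def block_no_def block_pos_def split: prod.split)

lemma upart_state [simp]: "upart (state u w) = u"
  by (simp add: upart_def state_def vec_eq_iff)

lemma wpart_state [simp]: "wpart (state u w) = w"
  by (simp add: wpart_def state_def vec_eq_iff)

lemma state_parts [simp]: "state (upart U) (wpart U) = U"
  by (simp add: state_def upart_def wpart_def vec_eq_iff split: sum.split)

lemma linear_upart: "linear upart"
  by (rule linearI) (simp_all add: upart_def vec_eq_iff)

lemma linear_wpart: "linear wpart"
  by (rule linearI) (simp_all add: wpart_def vec_eq_iff)

lemma state_add: "state u w + state u' w' = state (u + u') (w + w')"
  by (auto simp: state_def vec_eq_iff split: sum.split)

text \<open>This and the next two lemmas read blocks off from the action on \<open>state v 0\<close>
  and \<open>state 0 w\<close>, so that the entries of a product such as \<open>A j\<close> need not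
  be expanded.\<close>

lemma block11_mult: "block11 A *v v = upart (A *v state v 0)"
  by (simp add: vec_eq_iff upart_def block11_def state_def matrix_vector_mult_def
      UNIV_Plus_UNIV[symmetric] sum.Plus del: UNIV_Plus_UNIV)

lemma block12_mult: "block12 A *v w = upart (A *v state 0 w)"
  by (simp add: vec_eq_iff upart_def block12_def state_def matrix_vector_mult_def
      UNIV_Plus_UNIV[symmetric] sum.Plus del: UNIV_Plus_UNIV)

lemma block21_mult: "block21 A *v v = wpart (A *v state v 0)"
  by (simp add: vec_eq_iff wpart_def block21_def state_def matrix_vector_mult_def
      UNIV_Plus_UNIV[symmetric] sum.Plus del: UNIV_Plus_UNIV)

lemma inner_state: "state u w \<bullet> state u' w' = u \<bullet> u' + w \<bullet> w'"
  by (simp add: inner_vec_def state_def UNIV_Plus_UNIV[symmetric] sum.Plus del: UNIV_Plus_UNIV)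

lemma lower_block_mult: "lower_block S *v state u w = state 0 (S *v w)"
  by (auto simp: vec_eq_iff lower_block_def state_def matrix_vector_mult_def
      UNIV_Plus_UNIV[symmetric] sum.Plus simp del: UNIV_Plus_UNIV split: sum.split)

section \<open>Symmetric positive definite matrices and common eigenbases\<close>

lemma sym_pos_defD: "sym_pos_def A \<Longrightarrow> x \<bullet> (A *v y) = (A *v x) \<bullet> y"
  by (metis sym_pos_def_def dot_lmul_matrix transpose_matrix_vector)

lemma dot_transpose_mult: "(x::real^'n) \<bullet> (transpose A *v y) = (A *v x) \<bullet> (y::real^'m)"
  by (metis dot_lmul_matrix transpose_matrix_vector transpose_transpose)

lemma matrix_inv_mult:
  assumes "invertible A"
  shows "A ** matrix_inv A = mat 1" "matrix_inv A ** A = mat 1"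
  using someI_ex[OF assms[unfolded invertible_def]] by (auto simp: matrix_inv_def)

lemma sym_pos_def_congruence:
  fixes A R :: "real^'n^'n"
  assumes "sym_pos_def A" "invertible R"
  shows "sym_pos_def (transpose R ** A ** R)"
proof -
  have "v \<bullet> ((transpose R ** A ** R) *v v) > 0" if "v \<noteq> 0" for v
  proof -
    have "R *v v \<noteq> 0"
      using assms(2) that by (metis invertible_left_inverse matrix_left_invertible_ker)
    then show ?thesis using assms(1)
      by (simp add: sym_pos_def_def matrix_vector_mul_assoc[symmetric] dot_transpose_mult
          del: transpose_matrix_vector)
  qed
  moreover have "transpose (transpose R ** A ** R) = transpose R ** A ** R"
    using assms(1) by (simp add: sym_pos_def_def matrix_transpose_mul matrix_mul_assoc)
  ultimately show ?thesis by (simp add: sym_pos_def_def)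
qed

text \<open>For \<open>A = R \<Lambda> R\<inverse>\<close> one takes \<open>D = R\<^sup>-\<^sup>T \<Lambda>\<inverse> R\<inverse>\<close>, so that \<open>D A = R\<^sup>-\<^sup>T R\<inverse>\<close> for all \<open>A\<close>.\<close>

lemma common_eigenbasis_symmetrizer:
  fixes \<A> \<P> :: "(real^'n^'n) set"
  assumes basis: "common_eigenbasis \<A>" and "\<P> \<subseteq> \<A>"
    and pos: "\<And>A. A \<in> \<P> \<Longrightarrow> positive_eigenvalues A"
  obtains G where "\<And>A. A \<in> \<P> \<Longrightarrow> \<exists>D. sym_pos_def D \<and> D ** A = G"
proof -
  obtain b where ind: "independent b" and span: "span b = UNIV"
    and eig: "\<And>v A. v \<in> b \<Longrightarrow> A \<in> \<A> \<Longrightarrow> eigenvector A v"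
    using basis unfolding common_eigenbasis_def by metis
  have fin: "finite b" using ind by (rule finiteI_independent)
  have "card b = dim (UNIV :: (real^'n) set)"
    using ind span by (metis basis_card_eq_dim span_UNIV dim_span top_greatest subset_refl)
  then have "card b = card (UNIV :: 'n set)" by simp
  then obtain v where v: "bij_betw v (UNIV :: 'n set) b"
    using fin by (metis finite_same_card_bij finite)
  \<comment> \<open>The columns of \<open>R\<close> are the common eigenvectors, so the same
    \<open>R\<close> diagonalizes every matrix of the family.\<close>
  define R :: "real^'n^'n" where "R = (\<chi> i j. v j $ i)"
  have cols: "columns R = b"
    using v by (auto simp: columns_def column_def R_def bij_betw_def)
  have "surj ((*v) R)"
    using span by (simp add: cols[symmetric] span_vec_eq
        matrix_right_invertible_span_columns matrix_right_invertible_surjective[symmetric])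
  then have inv: "invertible R"
    by (metis invertible_right_inverse matrix_right_invertible_surjective)
  define W where "W = matrix_inv R"
  have RW: "R ** W = mat 1" and WR: "W ** R = mat 1"
    unfolding W_def using inv by (simp_all add: matrix_inv_mult)
  have invW: "invertible W" using RW WR by (auto simp: invertible_def)
  \<comment> \<open>The witness for \<open>G\<close> does not mention the eigenvalues of
    \<open>A\<close>, hence it is shared by the whole family.\<close>
  have "\<exists>D. sym_pos_def D \<and> D ** A = transpose W ** W" if A: "A \<in> \<P>" for A
  proof -
    have "\<exists>c. A *v v j = c *\<^sub>R v j \<and> c > 0" for j
    proof -
      have vj: "eigenvector A (v j)"
        using eig A assms(2) v by (auto simp: bij_betw_def)
      then obtain c where c: "A *v v j = c *\<^sub>R v j" "v j \<noteq> 0" by (auto simp: eigenvector_def)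
      \<comment> \<open>Eigenvalues are complex by definition, so the real eigenvector is
        complexified before positivity can be applied.\<close>
      let ?w = "(\<chi> i. complex_of_real (v j $ i))"
      have "?w \<noteq> 0" using c(2) by (simp add: vec_eq_iff)
      moreover have "map_matrix complex_of_real A *v ?w = complex_of_real c *s ?w"
        using c(1) by (simp add: vec_eq_iff matrix_vector_mult_def map_matrix_def
            of_real_mult[symmetric] of_real_sum[symmetric] del: of_real_mult of_real_sum)
      ultimately have "complex_eigenvalue A (complex_of_real c)"
        unfolding complex_eigenvalue_def by blast
      then have "c > 0" using pos[OF A] by (force simp: positive_eigenvalues_def)
      with c show ?thesis by blast
    qed
    then obtain c where c: "\<And>j. A *v v j = c j *\<^sub>R v j" "\<And>j. c j > 0" by metis
    define \<Lambda> :: "real^'n^'n" where "\<Lambda> = (\<chi> i j. if i = j then c j else 0)"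
    define \<Lambda>' :: "real^'n^'n" where "\<Lambda>' = (\<chi> i j. if i = j then 1 / c j else 0)"
    have AR: "A ** R = R ** \<Lambda>"
      using c(1) by (simp add: vec_eq_iff matrix_matrix_mult_def R_def \<Lambda>_def
          matrix_vector_mult_def if_distrib sum.delta cong: if_cong)
    have WA: "W ** A = \<Lambda> ** W"
      by (metis AR RW WR matrix_mul_assoc matrix_mul_lid matrix_mul_rid)
    have \<Lambda>\<Lambda>: "\<Lambda>' ** \<Lambda> = mat 1"
      using c(2) by (simp add: vec_eq_iff matrix_matrix_mult_def \<Lambda>_def \<Lambda>'_def mat_def mult_delta_left
          sum.delta less_imp_neq[THEN not_sym] cong: if_cong)
    have "sym_pos_def \<Lambda>'"
    proof -
      have "x \<bullet> (\<Lambda>' *v x) > 0" if "x \<noteq> 0" for x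
      proof -
        obtain i where i: "x $ i \<noteq> 0" using \<open>x \<noteq> 0\<close> by (auto simp: vec_eq_iff)
        have "x \<bullet> (\<Lambda>' *v x) = (\<Sum>i\<in>UNIV. (x $ i)\<^sup>2 / c i)"
          by (simp add: inner_vec_def \<Lambda>'_def matrix_vector_mult_def if_distrib[of "\<lambda>y. y * _"]
              sum.delta power2_eq_square cong: if_cong)
        also have "\<dots> > 0"
          by (rule sum_pos2[of _ i]) (use i c(2) in \<open>auto simp: less_imp_le\<close>)
        finally show ?thesis .
      qed
      moreover have "transpose \<Lambda>' = \<Lambda>'" by (simp add: vec_eq_iff transpose_def \<Lambda>'_def)
      ultimately show ?thesis by (simp add: sym_pos_def_def)
    qed
    then have "sym_pos_def (transpose W ** \<Lambda>' ** W)"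
      using invW by (rule sym_pos_def_congruence)
    moreover have "transpose W ** \<Lambda>' ** W ** A = transpose W ** W"
      by (metis WA \<Lambda>\<Lambda> matrix_mul_assoc matrix_mul_lid)
    ultimately show ?thesis by blast
  qed
  then show ?thesis using that by blast
qed

section \<open>Block matrices and the explicit inverse of \<open>P\<close>\<close>

definition block_mat :: "('r::finite \<Rightarrow> nat) \<Rightarrow> (nat \<Rightarrow> nat \<Rightarrow> real^'k^'k) \<Rightarrow>
    real^('k + 'r \<times> 'k)^('k + 'r \<times> 'k)" where
  "block_mat e X = (\<chi> i j. X (block_no e i) (block_no e j) $ block_pos i $ block_pos j)"

lemma matrix_vector_mult_sum: "X *v (\<Sum>i\<in>I. f i) = (\<Sum>i\<in>I. X *v f i)"
  for X :: "real^'n^'m"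
  by (induction I rule: infinite_finite_induct) (auto simp: matrix_vector_right_distrib)

lemma matrix_sum_vector_mult: "(\<Sum>i\<in>I. X i) *v v = (\<Sum>i\<in>I. X i *v v)"
  for X :: "'i \<Rightarrow> real^'n^'m"
  by (induction I rule: infinite_finite_induct) (auto simp: matrix_vector_mult_add_rdistrib)

lemma matrix_vector_mult_uminus: "(- X) *v v = - (X *v v)" for X :: "real^'n^'m"
  by (simp add: vec_eq_iff matrix_vector_mult_def sum_negf)

locale block_labelling =
  fixes e :: "'r::finite \<Rightarrow> nat" and L :: nat
  assumes bij: "bij_betw e UNIV {2..L}" and L: "1 \<le> L"
begin

lemma e_ge_2: "2 \<le> e r" and e_le: "e r \<le> L"
  using bij_betwE[OF bij] by auto

lemma e_neq_1 [simp]: "e r \<noteq> 1" "e r \<noteq> Suc 0" "Suc 0 \<noteq> e r"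
  using e_ge_2[of r] by auto

lemma inv_e [simp]: "inv e (e r) = r" and inj_e [simp]: "e r = e s \<longleftrightarrow> r = s"
  using bij by (auto simp: bij_betw_def inj_def)

lemma sum_blocks: "(\<Sum>l=1..L. h l) = h 1 + (\<Sum>r\<in>UNIV. h (e r))"
proof -
  have "{1..L} = insert 1 {2..L}" using L by auto
  then show ?thesis by (simp add: sum.reindex_bij_betw[OF bij])
qed

lemma ball_blocks: "(\<forall>l\<in>{1..L}. p l) \<longleftrightarrow> p 1 \<and> (\<forall>r. p (e r))"
proof -
  have "{1..L} = insert 1 (e ` UNIV)" using L bij by (auto simp: bij_betw_def)
  then show ?thesis by simp
qed

lemma stack_unstack: "stack e (unstack e U) = U"
  by (auto simp: vec_eq_iff stack_def unstack_def block_no_def block_pos_def split: sum.split prod.split)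

lemma stack_eq_iff: "stack e \<phi> = stack e \<psi> \<longleftrightarrow> (\<forall>l\<in>{1..L}. \<phi> l = \<psi> l)"
  unfolding ball_blocks
  by (auto simp: vec_eq_iff stack_def block_no_def block_pos_def split: sum.split)

lemma inner_stack: "stack e \<phi> \<bullet> stack e \<psi> = (\<Sum>l=1..L. \<phi> l \<bullet> \<psi> l)"
  unfolding sum_blocks by (simp add: inner_vec_def sum_sum_type stack_def block_no_def block_pos_def)

lemma block_mat_stack:
  "block_mat e X *v stack e \<phi> = stack e (\<lambda>l. \<Sum>m=1..L. X l m *v \<phi> m)"
  unfolding sum_blocks
  by (simp add: vec_eq_iff matrix_vector_mult_def sum_sum_type stack_def block_mat_def
      block_no_def[of e "Inl _"] block_no_def[of e "Inr _"] block_pos_def[of "Inl _"]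
      block_pos_def[of "Inr _"])

lemma state_stack: "state v 0 = stack e (\<lambda>l. if l = 1 then v else 0)"
  by (auto simp: vec_eq_iff stack_def state_def block_no_def block_pos_def split: sum.split)

lemma state_0_stack: "state 0 w = stack e (\<lambda>l. if l = 1 then 0 else unstack e (state 0 w) l)"
  by (auto simp: vec_eq_iff stack_def state_def unstack_def block_no_def block_pos_def split: sum.split)

definition P_mat :: "(nat \<Rightarrow> real^'k^'k) \<Rightarrow> real^('k + 'r \<times> 'k)^('k + 'r \<times> 'k)" where
  "P_mat J =
     block_mat e (\<lambda>l m. if l = 1 then mat 1 else (if l = m then mat 1 else 0) - J l)"

text \<open>Solves \<open>P \<phi> = \<psi>\<close>: the first row gives the sum
  \<open>s = \<psi> 1\<close>, row \<open>l\<close> gives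
  \<open>\<phi> l = \<psi> l + J l s\<close>, and the first block is what remains of
  \<open>s\<close>, namely \<open>J 1 s\<close> minus the other \<open>\<psi> l\<close> when the
  \<open>J l\<close> add up to the identity.\<close>

definition Pinv_mat :: "(nat \<Rightarrow> real^'k^'k) \<Rightarrow> real^('k + 'r \<times> 'k)^('k + 'r \<times> 'k)" where
  "Pinv_mat J = block_mat e (\<lambda>l m. if m = 1 then J l
     else if l = 1 then - mat 1 else if l = m then mat 1 else 0)"

definition diag_mat :: "(nat \<Rightarrow> real^'k^'k) \<Rightarrow> real^('k + 'r \<times> 'k)^('k + 'r \<times> 'k)" where
  "diag_mat D = block_mat e (\<lambda>l m. if l = m then D l else 0)"

lemma P_mat_stack:
  "P_mat J *v stack e \<phi> =
     stack e (\<lambda>l. if l = 1 then \<Sum>m=1..L. \<phi> m else \<phi> l - J l *v (\<Sum>m=1..L. \<phi> m))"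
  unfolding P_mat_def block_mat_stack stack_eq_iff
  by (auto simp: matrix_vector_mult_diff_rdistrib sum_subtractf matrix_vector_mult_sum
      if_distrib[of "\<lambda>X. X *v _"] cong: if_cong)

lemma Pinv_mat_stack:
  "Pinv_mat J *v stack e \<psi> =
     stack e (\<lambda>l. if l = 1 then J 1 *v \<psi> 1 - (\<Sum>r\<in>UNIV. \<psi> (e r)) else J l *v \<psi> 1 + \<psi> l)"
  unfolding Pinv_mat_def block_mat_stack stack_eq_iff ball_blocks
  by (simp add: sum_blocks if_distrib[of "\<lambda>X. X *v _"] sum_negf matrix_vector_mult_uminus
      del: One_nat_def cong: if_cong)

lemma diag_mat_stack: "diag_mat D *v stack e \<phi> = stack e (\<lambda>l. D l *v \<phi> l)"
  unfolding diag_mat_def block_mat_stack stack_eq_iff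
  by (auto simp: if_distrib[of "\<lambda>X. X *v _"] cong: if_cong)

text \<open>Every vector is a \<open>stack\<close>, so equality of matrices may be tested on block
  tuples.\<close>

lemma matrix_eq_stackI:
  assumes "\<And>\<phi>. X *v stack e \<phi> = Y *v stack e \<phi>"
  shows "X = Y"
  unfolding matrix_eq using assms stack_unstack by metis

lemma
  fixes J :: "nat \<Rightarrow> real^'k^'k"
  assumes J: "(\<Sum>l=1..L. J l) = mat 1"
  shows Pinv_P: "Pinv_mat J ** P_mat J = mat 1"
    and P_Pinv: "P_mat J ** Pinv_mat J = mat 1"
    and invertible_P: "invertible (P_mat J)"
    and matrix_inv_P: "matrix_inv (P_mat J) = Pinv_mat J"
proof -
  have J1: "J 1 = mat 1 - (\<Sum>r\<in>UNIV. J (e r))"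
    using J unfolding sum_blocks by (simp add: algebra_simps)
  show 1: "Pinv_mat J ** P_mat J = mat 1"
  proof (rule matrix_eq_stackI)
    fix \<phi> :: "nat \<Rightarrow> real^'k"
    define s where "s = (\<Sum>m=1..L. \<phi> m)"
    \<comment> \<open>The first block is the only one in which the normalization of \<open>J\<close>
      enters, through \<open>J1\<close>.\<close>
    have "J 1 *v s - (\<Sum>r\<in>UNIV. \<phi> (e r) - J (e r) *v s) = \<phi> 1"
      unfolding J1 matrix_vector_mult_diff_rdistrib matrix_sum_vector_mult sum_subtractf
      by (simp add: s_def[unfolded sum_blocks])
    then show "(Pinv_mat J ** P_mat J) *v stack e \<phi> = mat 1 *v stack e \<phi>"
      by (simp add: matrix_vector_mul_assoc[symmetric] P_mat_stack Pinv_mat_stack stack_eq_iff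
          ball_blocks s_def[symmetric] del: One_nat_def)
  qed
  then show 2: "P_mat J ** Pinv_mat J = mat 1" by (simp add: matrix_left_right_inverse)
  show "invertible (P_mat J)" using 1 2 by (auto simp: invertible_def)
  then show "matrix_inv (P_mat J) = Pinv_mat J"
    using 2 by (metis matrix_inv_mult(2) matrix_mul_assoc matrix_mul_lid matrix_mul_rid)
qed

end

section \<open>Calculus\<close>

lemma frechet_derivative_cong_open:
  assumes "open S" "x \<in> S" "\<And>x. x \<in> S \<Longrightarrow> f x = g x"
  shows "frechet_derivative f (at x) = frechet_derivative g (at x)"
proof -
  have "(f has_derivative D) (at x) \<longleftrightarrow> (g has_derivative D) (at x)" for D
    using assms by (metis has_derivative_transform_within_open)
  then show ?thesis by (simp add: frechet_derivative_def)
qed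

text \<open>Openness makes agreement on \<open>S\<close> agreement near each point, which the
  full-space derivative inside \<open>Ck_on\<close> requires.\<close>

lemma Ck_on_cong:
  assumes "open S" "\<And>x. x \<in> S \<Longrightarrow> f x = g x"
  shows "Ck_on n f S \<longleftrightarrow> Ck_on n g S"
  using assms(2)
proof (induction n arbitrary: f g)
  case 0
  then show ?case by (simp cong: continuous_on_cong)
next
  case (Suc n)
  have "f differentiable_on S \<longleftrightarrow> g differentiable_on S"
    unfolding differentiable_on_def differentiable_def
    using Suc.prems by (metis (no_types, lifting) has_derivative_transform)
  moreover have "Ck_on n (\<lambda>x. frechet_derivative f (at x) b) S
      \<longleftrightarrow> Ck_on n (\<lambda>x. frechet_derivative g (at x) b) S" for b
    by (rule Suc.IH) (use frechet_derivative_cong_open[OF assms(1)] Suc.prems in metis)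
  ultimately show ?case by simp
qed

lemma Ck_on_subset:
  assumes "Ck_on n f S" "T \<subseteq> S"
  shows "Ck_on n f T"
  using assms(1)
proof (induction n arbitrary: f)
  case 0
  then show ?case using assms(2) continuous_on_subset by auto
next
  case (Suc n)
  then show ?case using assms(2) by (auto intro: differentiable_on_subset)
qed

text \<open>Uniqueness of the derivative at a point lets any explicit \<open>f'\<close> replace
  \<open>frechet_derivative\<close>; this drives the inductions below.\<close>

lemma Ck_on_SucI:
  assumes "open S" "\<And>x. x \<in> S \<Longrightarrow> (f has_derivative f' x) (at x)"
    and "\<And>b. b \<in> Basis \<Longrightarrow> Ck_on n (\<lambda>x. f' x b) S"
  shows "Ck_on (Suc n) f S"
proof -
  have "frechet_derivative f (at x) = f' x" if "x \<in> S" for x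
    using assms(2)[OF that] by (rule frechet_derivative_at[symmetric])
  then have "Ck_on n (\<lambda>x. frechet_derivative f (at x) b) S" if "b \<in> Basis" for b
    using assms(3)[OF that] by (subst Ck_on_cong[OF assms(1), where g = "\<lambda>x. f' x b"]) auto
  moreover have "f differentiable_on S"
    using assms(1,2) by (auto simp: differentiable_on_eq_differentiable_at intro: differentiableI)
  ultimately show ?thesis by simp
qed

lemma Ck_on_SucD:
  assumes "open S" "Ck_on (Suc n) f S" "x \<in> S"
  shows "(f has_derivative frechet_derivative f (at x)) (at x)"
  using assms by (simp add: differentiable_on_eq_differentiable_at frechet_derivative_works)

lemma Ck_on_differentiable:
  "Ck_on 1 f S \<Longrightarrow> open S \<Longrightarrow> x \<in> S \<Longrightarrow> f differentiable (at x)"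
  by (simp add: differentiable_on_eq_differentiable_at)

lemma Ck_on_Suc_imp:
  assumes "Ck_on (Suc n) f S"
  shows "Ck_on n f S"
  using assms
proof (induction n arbitrary: f)
  case 0
  then show ?case by (auto intro: differentiable_imp_continuous_on)
next
  case (Suc n)
  then show ?case by auto
qed

lemma Ck_on_const: "open S \<Longrightarrow> Ck_on n (\<lambda>_. c) S"
proof (induction n arbitrary: c)
  case (Suc n)
  then show ?case
    by (intro Ck_on_SucI[of S _ "\<lambda>_ _. 0"]) auto
qed auto

lemma Ck_on_bounded_linear:
  assumes "open S" "bounded_linear h"
  shows "Ck_on n h S"
proof (cases n)
  case 0
  then show ?thesis using assms by (auto intro: linear_continuous_on)
next
  case (Suc m)
  then show ?thesis using assms
    by (auto intro!: Ck_on_SucI[of S _ "\<lambda>_. h"] bounded_linear_imp_has_derivative Ck_on_const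
        simp del: Ck_on.simps)
qed

lemma Ck_on_add:
  assumes "open S" "Ck_on n f S" "Ck_on n g S"
  shows "Ck_on n (\<lambda>x. f x + g x) S"
  using assms(2,3)
proof (induction n arbitrary: f g)
  case 0
  then show ?case by (auto intro: continuous_on_add)
next
  case (Suc n)
  show ?case
    by (rule Ck_on_SucI[OF assms(1) has_derivative_add[OF Ck_on_SucD[OF assms(1) Suc.prems(1)]
            Ck_on_SucD[OF assms(1) Suc.prems(2)]]])
      (use Suc in auto)
qed

lemma Ck_on_sum:
  assumes "open S" "\<And>i. i \<in> I \<Longrightarrow> Ck_on n (f i) S"
  shows "Ck_on n (\<lambda>x. \<Sum>i\<in>I. f i x) S"
  using assms(2)
  by (induction I rule: infinite_finite_induct) (auto intro: Ck_on_const Ck_on_add assms(1))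

lemma Ck_on_linear_comp:
  assumes "open S" "bounded_linear h" "Ck_on n f S"
  shows "Ck_on n (\<lambda>x. h (f x)) S"
  using assms(3)
proof (induction n arbitrary: f)
  case 0
  then show ?case
    using assms(2) by (auto intro: bounded_linear.continuous_on)
next
  case (Suc n)
  show ?case
    by (rule Ck_on_SucI[OF assms(1) bounded_linear.has_derivative[OF assms(2)
            Ck_on_SucD[OF assms(1) Suc.prems]]])
      (use Suc in auto)
qed

text \<open>Leibniz rule: each directional derivative is a sum of two products of the same kind, in
  which the undifferentiated factor is lowered from order \<open>Suc n\<close> to \<open>n\<close>,
  so the induction closes.\<close>

lemma Ck_on_bilinear:
  assumes "open S" "bounded_bilinear p" "Ck_on n f S" "Ck_on n g S"
  shows "Ck_on n (\<lambda>x. p (f x) (g x)) S"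
  using assms(3,4)
proof (induction n arbitrary: f g)
  case 0
  then show ?case using assms(2) by (auto intro: bounded_bilinear.continuous_on)
next
  case (Suc n)
  have "Ck_on n f S" "Ck_on n g S" using Suc.prems by (auto intro: Ck_on_Suc_imp simp del: Ck_on.simps)
  then show ?case
    by (intro Ck_on_SucI[OF assms(1) bounded_bilinear.FDERIV[OF assms(2)
            Ck_on_SucD[OF assms(1) Suc.prems(1)] Ck_on_SucD[OF assms(1) Suc.prems(2)]]]
          Ck_on_add assms(1) Suc.IH)
      (use Suc.prems in auto)
qed

text \<open>The derivative along \<open>b\<close> is that of \<open>f\<close> along
  \<open>h b\<close>, which need not be a basis vector; expanding it in \<open>Basis\<close> leads
  back to directions covered by the induction hypothesis.\<close>

lemma Ck_on_comp_linear:
  fixes h :: "'a::euclidean_space \<Rightarrow> 'b::euclidean_space"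
  assumes "open S" "bounded_linear h" "Ck_on n f S"
  shows "Ck_on n (\<lambda>x. f (h x)) (h -` S)"
  using assms(3)
proof (induction n arbitrary: f)
  case 0
  then show ?case using assms(2)
    by (auto intro: continuous_on_compose2 linear_continuous_on)
next
  case (Suc n)
  have op: "open (h -` S)"
    using assms(1,2) by (simp add: continuous_on_open_vimage[of UNIV, simplified, symmetric]
        linear_continuous_on open_vimage)
  have der: "((\<lambda>x. f (h x)) has_derivative (\<lambda>y. frechet_derivative f (at (h x)) (h y))) (at x)"
    if "x \<in> h -` S" for x
    using that by (intro has_derivative_compose[OF bounded_linear_imp_has_derivative[OF assms(2)]]
        Ck_on_SucD[OF assms(1) Suc.prems]) auto
  show ?case
  proof (rule Ck_on_SucI[OF op der])
    fix b :: 'a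
    have "Ck_on n (\<lambda>x. \<Sum>c\<in>Basis. (h b \<bullet> c) *\<^sub>R frechet_derivative f (at (h x)) c) (h -` S)"
      using Suc by (auto intro!: Ck_on_sum Ck_on_linear_comp[OF op bounded_linear_scaleR_right] op)
    moreover have "frechet_derivative f (at (h x)) (h b)
        = (\<Sum>c\<in>Basis. (h b \<bullet> c) *\<^sub>R frechet_derivative f (at (h x)) c)" if "x \<in> h -` S" for x
    proof -
      interpret linear "frechet_derivative f (at (h x))"
        using Ck_on_SucD[OF assms(1) Suc.prems, of "h x"] that
        by (auto intro: has_derivative_linear)
      show ?thesis
        by (subst euclidean_representation[of "h b", symmetric]) (simp add: sum scaleR)
    qed
    ultimately show "Ck_on n (\<lambda>x. frechet_derivative f (at (h x)) (h b)) (h -` S)"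
      using Ck_on_cong[OF op] by (metis (mono_tags, lifting))
  qed
qed

text \<open>The function is the sum of its components embedded by \<open>axis\<close>, which reduces
  the claim to sums and linear maps.\<close>

lemma Ck_on_vec:
  fixes f :: "'a::euclidean_space \<Rightarrow> 'b::real_normed_vector^'c"
  assumes "open S" "\<And>i. Ck_on n (\<lambda>x. f x $ i) S"
  shows "Ck_on n f S"
proof -
  have norm_axis_eq: "norm (axis i y :: 'b^'c) = norm y" for i y
    by (simp add: norm_vec_def axis_def L2_set_def if_distrib[of "\<lambda>z. (norm z)\<^sup>2"] cong: if_cong)
  have lin: "bounded_linear (\<lambda>y. axis i y :: 'b^'c)" for i
    by (rule bounded_linear_intro[where K=1]) (simp_all add: axis_def vec_eq_iff norm_axis_eq[unfolded axis_def])
  have "f x = (\<Sum>i\<in>UNIV. axis i (f x $ i))" for x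
    by (simp add: vec_eq_iff axis_def if_distrib cong: if_cong)
  then have "f = (\<lambda>x. \<Sum>i\<in>UNIV. axis i (f x $ i))" by (rule ext)
  moreover have "Ck_on n (\<lambda>x. \<Sum>i\<in>UNIV. axis i (f x $ i)) S"
    by (intro Ck_on_sum assms(1) Ck_on_linear_comp[OF assms(1) lin] assms(2))
  ultimately show ?thesis by simp
qed

lemma bounded_bilinear_matrix_mult:
  "bounded_bilinear (\<lambda>(X :: real^'m^'n) (Y :: real^'k^'m). X ** Y)"
proof -
  have "bilinear (\<lambda>(X :: real^'m^'n) (Y :: real^'k^'m). X ** Y)"
    by (auto simp: bilinear_def linear_iff vec_eq_iff matrix_matrix_mult_def algebra_simps
        sum.distrib sum_distrib_left)
  then show ?thesis by (simp add: bilinear_conv_bounded_bilinear)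
qed

lemma bounded_bilinear_matrix_vector_mult:
  "bounded_bilinear (\<lambda>(X :: real^'m^'n) v. X *v v)"
proof -
  have "bilinear (\<lambda>(X :: real^'m^'n) v. X *v v)"
    by (auto simp: bilinear_def linear_iff vec_eq_iff matrix_vector_mult_def algebra_simps
        sum.distrib sum_distrib_left)
  then show ?thesis by (simp add: bilinear_conv_bounded_bilinear)
qed

lemma smooth_on_openI: "open T \<Longrightarrow> S \<subseteq> T \<Longrightarrow> (\<And>n. Ck_on n f T) \<Longrightarrow> smooth_on S f"
  unfolding smooth_on_def by blast

text \<open>For open \<open>S\<close> the extension demanded by \<open>smooth_on\<close> can be
  restricted back to \<open>S\<close>.\<close>

lemma smooth_on_openD:
  assumes "smooth_on S f" "open S"
  shows "Ck_on n f S"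
proof -
  obtain T g where "open T" "S \<subseteq> T" "\<And>n. Ck_on n g T" "\<And>x. x \<in> S \<Longrightarrow> g x = f x"
    using assms(1) unfolding smooth_on_def by metis
  then show ?thesis using Ck_on_subset Ck_on_cong[OF assms(2)] by metis
qed

lemma smooth_on_linear: "bounded_linear f \<Longrightarrow> smooth_on S f"
  by (rule smooth_on_openI[of UNIV]) (auto intro: Ck_on_bounded_linear)

section \<open>Jacobians and partial derivatives\<close>

lemma has_derivative_jacobian:
  fixes f :: "real^'n \<Rightarrow> real^'m"
  assumes "f differentiable (at x)"
  shows "(f has_derivative (\<lambda>h. jacobian f (at x) *v h)) (at x)"
  using assms jacobian_works by blast

lemma jacobian_eqI:
  fixes f :: "real^'n \<Rightarrow> real^'m"
  assumes "(f has_derivative (\<lambda>h. A *v h)) (at x)"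
  shows "jacobian f (at x) = A"
  by (simp add: jacobian_def frechet_derivative_at[OF assms, symmetric] matrix_of_matrix_vector_mul)

lemma Ck_on_jacobian:
  fixes f :: "real^'n \<Rightarrow> real^'m"
  assumes "open S" "Ck_on (Suc n) f S"
  shows "Ck_on n (\<lambda>x. jacobian f (at x)) S"
proof (intro Ck_on_vec assms(1))
  fix i j
  have "Ck_on n (\<lambda>x. frechet_derivative f (at x) (axis j 1)) S"
    using assms(2) axis_in_Basis_iff by (auto simp: axis_in_Basis_iff)
  then have "Ck_on n (\<lambda>x. frechet_derivative f (at x) (axis j 1) $ i) S"
    by (rule Ck_on_linear_comp[OF assms(1) bounded_linear_vec_nth])
  then show "Ck_on n (\<lambda>x. jacobian f (at x) $ i $ j) S"
    by (simp add: jacobian_def matrix_def)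
qed

lemma dx_eq:
  assumes "(h has_derivative h') (at z)"
  shows "dx j h z = h' (axis j 1, 0)"
proof -
  have "((\<lambda>s. (fst z + s *\<^sub>R axis j 1, snd z)) has_derivative (\<lambda>s. (s *\<^sub>R axis j 1, 0))) (at 0)"
    by (auto intro!: derivative_eq_intros)
  from has_derivative_compose[OF this, of h h'] assms
  have "((\<lambda>s. h (fst z + s *\<^sub>R axis j 1, snd z)) has_derivative (\<lambda>s. h' (s *\<^sub>R axis j 1, 0))) (at 0)"
    by simp
  moreover have "h' (s *\<^sub>R axis j 1, 0) = s *\<^sub>R h' (axis j 1, 0)" for s
    using linear_scale[OF has_derivative_linear[OF assms], of s "(axis j 1, 0)"] by simp
  ultimately show ?thesis
    by (simp add: dx_def vector_derivative_at has_vector_derivative_def)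
qed

lemma dt_eq:
  assumes "(h has_derivative h') (at z)"
  shows "dt h z = h' (0, 1)"
proof -
  have "((\<lambda>s. (fst z, s)) has_derivative (\<lambda>s. (0, s))) (at (snd z))"
    by (auto intro!: derivative_eq_intros)
  from has_derivative_compose[OF this, of h h'] assms
  have "((\<lambda>s. h (fst z, s)) has_derivative (\<lambda>s. h' (0, s))) (at (snd z))"
    by simp
  moreover have "(\<lambda>s. h' (0, s)) = (\<lambda>s. s *\<^sub>R h' (0, 1))"
    using linear_scale[OF has_derivative_linear[OF assms], of _ "(0, 1)",
        unfolded scaleR_Pair scaleR_zero_right real_scaleR_def mult_1_right] by (rule ext)
  ultimately have "((\<lambda>s. h (fst z, s)) has_vector_derivative h' (0, 1)) (at (snd z))"
    by (simp only: has_vector_derivative_def)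
  then show ?thesis by (simp add: dt_def vector_derivative_at)
qed

lemma has_derivative_vec:
  fixes f :: "'a::real_normed_vector \<Rightarrow> real^'n"
  assumes "\<And>i. ((\<lambda>x. f x $ i) has_derivative (\<lambda>h. f' h $ i)) (at a within S)"
  shows "(f has_derivative f') (at a within S)"
  using assms by (subst has_derivative_componentwise_within) (auto simp: Basis_vec_def inner_axis)

lemma Ck_on_minus:
  assumes "open S" "Ck_on n f S" "Ck_on n g S"
  shows "Ck_on n (\<lambda>x. f x - g x) S"
  using Ck_on_add[OF assms(1,2) Ck_on_linear_comp[OF assms(1) bounded_linear_minus[OF bounded_linear_ident] assms(3)]]
  by simp

section \<open>The block matrices of the kinetic system\<close>

lemma sum_split: "(\<Sum>l=1..N+N'. h l) = (\<Sum>l=1..N. h l) + (\<Sum>m=1..N'. h (N + m))"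
  for h :: "nat \<Rightarrow> 'a::comm_monoid_add"
  by (induction N') (simp_all add: add.assoc)

lemma ball_split: "(\<forall>l\<in>{1..N+N'}. p l) \<longleftrightarrow> (\<forall>l\<in>{1..N}. p l) \<and> (\<forall>m\<in>{1..N'}. p (N + m))"
  for N N' :: nat
proof -
  have "{1..N+N'} = {1..N} \<union> (\<lambda>m. N + m) ` {1..N'}"
  proof (intro equalityI subsetI)
    fix l assume l: "l \<in> {1..N+N'}"
    show "l \<in> {1..N} \<union> (\<lambda>m. N + m) ` {1..N'}"
    proof (cases "l \<le> N")
      case False
      then have "l = N + (l - N)" "l - N \<in> {1..N'}" using l by auto
      then show ?thesis by blast
    qed (use l in auto)
  qed auto
  then show ?thesis by (simp only: ball_Un ball_simps)
qed

lemma stack_add: "stack e \<phi> + stack e \<psi> = stack e (\<lambda>l. \<phi> l + \<psi> l)"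
  by (simp add: stack_def vec_eq_iff)

lemma stack_scaleR: "c *\<^sub>R stack e \<phi> = stack e (\<lambda>l. c *\<^sub>R \<phi> l)"
  by (simp add: stack_def vec_eq_iff)

lemma stack_sum: "(\<Sum>i\<in>I. stack e (\<phi> i)) = stack e (\<lambda>l. \<Sum>i\<in>I. \<phi> i l)"
  by (simp add: stack_def vec_eq_iff)

lemma scaleR_mat_mult: "(c *\<^sub>R X) *v v = c *\<^sub>R (X *v v)" for X :: "real^'n^'m"
  by (simp add: vec_eq_iff matrix_vector_mult_def sum_distrib_left mult.assoc)

context block_labelling
begin

text \<open>Lets the entrywise rules below ask about a block only for numbers in
  \<open>{1..L}\<close>.\<close>

lemma block_no_range: "block_no e i \<in> {1..L}"
proof (cases i)
  case (Inl k)
  then show ?thesis using L by (simp add: block_no_def)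
next
  case (Inr b)
  then show ?thesis using e_ge_2[of "fst b"] e_le[of "fst b"]
    by (cases b) (simp add: block_no_def)
qed

lemma has_derivative_stack:
  fixes \<phi> :: "'a::real_normed_vector \<Rightarrow> nat \<Rightarrow> real^'k"
  assumes "\<And>l. l \<in> {1..L} \<Longrightarrow> ((\<lambda>x. \<phi> x l) has_derivative (\<lambda>h. \<phi>' h l)) (at a within S)"
  shows "((\<lambda>x. stack e (\<phi> x)) has_derivative (\<lambda>h. stack e (\<phi>' h))) (at a within S)"
proof (rule has_derivative_vec)
  fix i
  show "((\<lambda>x. stack e (\<phi> x) $ i) has_derivative (\<lambda>h. stack e (\<phi>' h) $ i)) (at a within S)"
    using bounded_linear.has_derivative[OF bounded_linear_vec_nth assms[OF block_no_range]]
    by (simp add: stack_def)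
qed

lemma Ck_on_block_mat:
  assumes "open S" "\<And>l m. l \<in> {1..L} \<Longrightarrow> m \<in> {1..L} \<Longrightarrow> Ck_on n (\<lambda>x. X x l m) S"
  shows "Ck_on n (\<lambda>x. block_mat e (X x)) S"
proof (intro Ck_on_vec assms(1))
  fix i j
  have "Ck_on n (\<lambda>x. X x (block_no e i) (block_no e j) $ block_pos i $ block_pos j) S"
    by (intro Ck_on_linear_comp[OF assms(1) bounded_linear_vec_nth] assms(2) block_no_range)
  then show "Ck_on n (\<lambda>x. block_mat e (X x) $ i $ j) S" by (simp add: block_mat_def)
qed

lemma Ck_on_P_mat:
  assumes "open S" "\<And>l. l \<in> {1..L} \<Longrightarrow> Ck_on n (\<lambda>x. J x l) S"
  shows "Ck_on n (\<lambda>x. P_mat (J x)) S"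
  unfolding P_mat_def
proof (rule Ck_on_block_mat[OF assms(1)])
  fix l m assume "l \<in> {1..L}"
  then show "Ck_on n (\<lambda>x. if l = 1 then mat 1 else (if l = m then mat 1 else 0) - J x l) S"
    using assms by (cases "l = 1") (simp_all add: Ck_on_const Ck_on_minus del: diff_0)
qed

lemma Ck_on_Pinv_mat:
  assumes "open S" "\<And>l. l \<in> {1..L} \<Longrightarrow> Ck_on n (\<lambda>x. J x l) S"
  shows "Ck_on n (\<lambda>x. Pinv_mat (J x)) S"
  unfolding Pinv_mat_def
proof (rule Ck_on_block_mat[OF assms(1)])
  fix l m assume "l \<in> {1..L}"
  then show "Ck_on n (\<lambda>x. if m = 1 then J x l else if l = 1 then - mat 1
      else if l = m then mat 1 else 0) S"
    by (cases "m = 1") (auto intro!: Ck_on_const assms)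
qed

lemma transpose_diag_mat:
  assumes "\<And>l. l \<in> {1..L} \<Longrightarrow> transpose (D l) = D l"
  shows "transpose (diag_mat D) = diag_mat D"
proof -
  have *: "D (block_no e i) $ p $ q = D (block_no e i) $ q $ p" for i p q
    using arg_cong[OF assms[OF block_no_range[of i]], of "\<lambda>X. X $ p $ q"]
    by (simp add: transpose_def)
  show ?thesis
    by (auto simp: diag_mat_def block_mat_def transpose_def vec_eq_iff intro: *)
qed

text \<open>On \<open>stack e \<phi>\<close> the quadratic form is the sum of the forms of the
  blocks, and one nonzero block makes it positive.\<close>

lemma sym_pos_def_diag_mat:
  assumes "\<And>l. l \<in> {1..L} \<Longrightarrow> sym_pos_def (D l)"
  shows "sym_pos_def (diag_mat D)"
proof -
  have "v \<bullet> (diag_mat D *v v) > 0" if "v \<noteq> 0" for v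
  proof -
    define \<phi> where "\<phi> = unstack e v"
    have v: "v = stack e \<phi>" by (simp add: \<phi>_def stack_unstack)
    have "stack e \<phi> \<noteq> stack e (\<lambda>_. 0)"
      using \<open>v \<noteq> 0\<close> by (simp add: v stack_def vec_eq_iff)
    then obtain l where l: "l \<in> {1..L}" "\<phi> l \<noteq> 0" by (auto simp: stack_eq_iff)
    have "v \<bullet> (diag_mat D *v v) = (\<Sum>l=1..L. \<phi> l \<bullet> (D l *v \<phi> l))"
      by (simp add: v diag_mat_stack inner_stack)
    also have "\<dots> > 0"
    proof (rule sum_pos2[OF _ l(1)])
      show "\<phi> l \<bullet> (D l *v \<phi> l) > 0" using assms[OF l(1)] l(2) by (simp add: sym_pos_def_def)
      show "\<phi> i \<bullet> (D i *v \<phi> i) \<ge> 0" if "i \<in> {1..L}" for i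
        using assms[OF that] by (cases "\<phi> i = 0") (auto simp: sym_pos_def_def less_imp_le)
    qed auto
    finally show ?thesis .
  qed
  then show ?thesis
    using transpose_diag_mat[of D] assms by (auto simp: sym_pos_def_def)
qed

text \<open>The two block columns of the inverse. In the second, the first block is minus the sum of
  all the others.\<close>

lemma Pinv_mat_state:
  "Pinv_mat J *v state v 0 = stack e (\<lambda>l. J l *v v)"
  "Pinv_mat J *v state 0 w = stack e (\<lambda>l. if l = 1 then - (\<Sum>r\<in>UNIV. \<chi> k. w $ (r, k))
     else \<chi> k. w $ (inv e l, k))"
proof -
  have "unstack e (state 0 w) l = (\<chi> k. w $ (inv e l, k))" if "l \<noteq> 1" for l
    using that by (simp add: unstack_def state_def)
  then have w: "state 0 w = stack e (\<lambda>l. if l = 1 then 0 else \<chi> k. w $ (inv e l, k))"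
    by (subst state_0_stack) (simp add: stack_eq_iff)
  show "Pinv_mat J *v state v 0 = stack e (\<lambda>l. J l *v v)"
    by (simp add: state_stack Pinv_mat_stack stack_eq_iff)
  show "Pinv_mat J *v state 0 w = stack e (\<lambda>l. if l = 1 then - (\<Sum>r\<in>UNIV. \<chi> k. w $ (r, k))
     else \<chi> k. w $ (inv e l, k))"
    by (simp add: w Pinv_mat_stack stack_eq_iff del: One_nat_def)
qed

text \<open>The hypothesis \<open>D l J l = G\<close> makes the coupling block of the congruence transform of \<open>diag_mat D\<close>
  vanish, since the block rows of \<open>Pinv_mat J\<close> applied to \<open>(0,w)\<close> add up to zero.\<close>

lemma symmetrizer_decoupled:
  assumes "\<And>l. l \<in> {1..L} \<Longrightarrow> D l ** J l = G"
  shows "state 0 w \<bullet> ((transpose (Pinv_mat J) ** diag_mat D ** Pinv_mat J) *v state v 0) = 0"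
proof -
  have "diag_mat D *v (Pinv_mat J *v state v 0) = stack e (\<lambda>_. G *v v)"
    using assms by (auto simp: Pinv_mat_state diag_mat_stack stack_eq_iff matrix_vector_mul_assoc)
  then have "state 0 w \<bullet> ((transpose (Pinv_mat J) ** diag_mat D ** Pinv_mat J) *v state v 0)
      = (Pinv_mat J *v state 0 w) \<bullet> stack e (\<lambda>_. G *v v)"
    by (simp add: matrix_vector_mul_assoc[symmetric] dot_transpose_mult del: transpose_matrix_vector)
  also have "\<dots> = 0"
    by (simp add: Pinv_mat_state inner_stack sum_blocks inner_sum_left del: One_nat_def)
  finally show ?thesis .
qed

end

section \<open>The kinetic model\<close>

locale kinetic_system = block_labelling e "N + N'"
  for e :: "'r::finite \<Rightarrow> nat" and N N' :: nat +
  fixes \<Omega>u :: "(real^'k) set"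
    and F :: "'d::finite \<Rightarrow> real^'k \<Rightarrow> real^'k"
    and B :: "real^'k \<Rightarrow> real^'k"
    and M :: "nat \<Rightarrow> real^'k \<Rightarrow> real^'k"
    and lam \<sigma> :: "nat \<Rightarrow> 'd \<Rightarrow> real"
    and \<mu> \<theta> :: real
  assumes open_\<Omega>u: "open \<Omega>u"
    and smooth_B: "smooth_on \<Omega>u B"
    and smooth_M: "\<And>l. l \<in> {1..N} \<Longrightarrow> smooth_on \<Omega>u (M l)"
    and N: "N \<ge> 1"
    and N': "N' \<ge> 1"
    and theta: "\<theta> > 0"
    and sigma_sum: "\<And>j. (\<Sum>m=1..N'. \<sigma> m j) = 0"
    and sigma_orth: "\<And>i j. (\<Sum>m=1..N'. \<sigma> m j * \<sigma> m i) = (if i = j then 1 else 0)"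
    and M_sum: "\<And>u. u \<in> \<Omega>u \<Longrightarrow> (\<Sum>l=1..N. M l u) = u - (1 / \<theta>\<^sup>2) *\<^sub>R B u"
    and M_flux: "\<And>u j. u \<in> \<Omega>u \<Longrightarrow> (\<Sum>l=1..N. lam l j *\<^sub>R M l u) = F j u"
begin

section \<open>Maxwellians, scaled speeds and their moments\<close>

abbreviation Mx :: "nat \<Rightarrow> real^'k \<Rightarrow> real^'k" where "Mx \<equiv> maxwellian N N' \<theta> B M"

definition J :: "real^'k \<Rightarrow> nat \<Rightarrow> real^'k^'k" where "J u l = jacobian (Mx l) (at u)"

text \<open>The velocity of block \<open>l\<close> multiplied by \<open>\<epsilon>\<close>. In the
  diffusive blocks this absorbs the factor \<open>1 / \<epsilon>\<close> of \<open>\<gamma>\<close>,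
  so the expression stays regular at \<open>\<epsilon> = 0\<close>.\<close>

definition speed :: "'d \<Rightarrow> real \<Rightarrow> nat \<Rightarrow> real" where
  "speed j \<epsilon> l = (if l \<le> N then \<epsilon> * lam l j else \<sigma> (l - N) j * (\<epsilon> * \<mu> + \<theta> * sqrt (real N')))"

abbreviation A where "A \<equiv> kinetic_A N N' lam \<sigma> \<mu> \<theta> B M e"

lemma Mx_simps:
  "l \<le> N \<Longrightarrow> Mx l = M l" "1 \<le> m \<Longrightarrow> Mx (N + m) = (\<lambda>u. (1 / (real N' * \<theta>\<^sup>2)) *\<^sub>R B u)"
  by (simp_all add: maxwellian_def fun_eq_iff)

lemma Ck_on_B: "Ck_on n B \<Omega>u"
  using smooth_B open_\<Omega>u by (rule smooth_on_openD)

lemma Ck_on_Mx: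
  assumes "l \<in> {1..N + N'}"
  shows "Ck_on n (Mx l) \<Omega>u"
proof (cases "l \<le> N")
  case True
  then show ?thesis
    using assms smooth_on_openD[OF smooth_M open_\<Omega>u] by (simp add: Mx_simps)
next
  case False
  then have "Mx l = (\<lambda>u. (1 / (real N' * \<theta>\<^sup>2)) *\<^sub>R B u)" by (simp add: maxwellian_def fun_eq_iff)
  then show ?thesis
    using Ck_on_linear_comp[OF open_\<Omega>u bounded_linear_scaleR_right Ck_on_B] by simp
qed

lemma B_derivative:
  assumes "u \<in> \<Omega>u"
  shows "(B has_derivative (\<lambda>h. jacobian B (at u) *v h)) (at u)"
  by (rule has_derivative_jacobian[OF Ck_on_differentiable[OF Ck_on_B open_\<Omega>u assms]])

lemma Mx_derivative:
  assumes "l \<in> {1..N + N'}" "u \<in> \<Omega>u"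
  shows "(Mx l has_derivative (\<lambda>h. J u l *v h)) (at u)"
  unfolding J_def
  by (rule has_derivative_jacobian[OF Ck_on_differentiable[OF Ck_on_Mx open_\<Omega>u]]) (use assms in auto)

lemma Ck_on_J: "l \<in> {1..N + N'} \<Longrightarrow> Ck_on n (\<lambda>u. J u l) \<Omega>u"
  unfolding J_def by (intro Ck_on_jacobian open_\<Omega>u Ck_on_Mx)

text \<open>The diffusive blocks share one Jacobian, so sums over them reduce to sums of the
  coefficients \<open>\<sigma> m j\<close>.\<close>

lemma J_diffusive:
  assumes "1 \<le> m" "u \<in> \<Omega>u"
  shows "J u (N + m) = (1 / (real N' * \<theta>\<^sup>2)) *\<^sub>R jacobian B (at u)"
  unfolding J_def Mx_simps(2)[OF assms(1)]
  by (rule jacobian_eqI)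
    (auto intro!: derivative_eq_intros B_derivative[OF assms(2)] simp: scaleR_mat_mult)

text \<open>The \<open>N'\<close> diffusive Maxwellians contribute exactly the multiple of
  \<open>B u\<close> that the first \<open>N\<close> lack.\<close>

lemma Mx_sum:
  assumes "u \<in> \<Omega>u"
  shows "(\<Sum>l=1..N+N'. Mx l u) = u"
  using N' M_sum[OF assms]
  by (simp add: sum_split Mx_simps sum_constant_scaleR del: One_nat_def sum_constant)

text \<open>Differentiates \<open>Mx_sum\<close>, which holds near \<open>u\<close>. This is the
  condition under which \<open>Pinv_mat\<close> inverts \<open>P_mat\<close>.\<close>

lemma J_sum:
  assumes "u \<in> \<Omega>u"
  shows "(\<Sum>l=1..N+N'. J u l) = mat 1"
proof -
  have "((\<lambda>u. \<Sum>l=1..N+N'. Mx l u) has_derivative (\<lambda>h. \<Sum>l=1..N+N'. J u l *v h)) (at u)"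
    using assms by (intro has_derivative_sum Mx_derivative)
  then have "((\<lambda>u. u) has_derivative (\<lambda>h. (\<Sum>l=1..N+N'. J u l) *v h)) (at u)"
    unfolding matrix_sum_vector_mult
    by (rule has_derivative_transform_within_open[OF _ open_\<Omega>u assms]) (simp add: Mx_sum del: One_nat_def)
  from has_derivative_unique[OF this has_derivative_ident] show ?thesis
    unfolding matrix_eq by (metis matrix_vector_mul_lid)
qed

lemma F_derivative:
  assumes "u \<in> \<Omega>u"
  shows "(F j has_derivative (\<lambda>h. jacobian (F j) (at u) *v h)) (at u)"
    and "jacobian (F j) (at u) = (\<Sum>l=1..N. lam l j *\<^sub>R J u l)"
proof -
  have "((\<lambda>u. \<Sum>l=1..N. lam l j *\<^sub>R Mx l u) has_derivative (\<lambda>h. \<Sum>l=1..N. lam l j *\<^sub>R (J u l *v h))) (at u)"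
    using assms by (intro has_derivative_sum has_derivative_scaleR_right Mx_derivative) auto
  then have *: "(F j has_derivative (\<lambda>h. (\<Sum>l=1..N. lam l j *\<^sub>R J u l) *v h)) (at u)"
    unfolding matrix_sum_vector_mult scaleR_mat_mult
    by (rule has_derivative_transform_within_open[OF _ open_\<Omega>u assms])
      (simp add: M_flux[symmetric] Mx_simps)
  then show "jacobian (F j) (at u) = (\<Sum>l=1..N. lam l j *\<^sub>R J u l)" by (rule jacobian_eqI)
  with * show "(F j has_derivative (\<lambda>h. jacobian (F j) (at u) *v h)) (at u)" by simp
qed

text \<open>The diffusive part vanishes because the Jacobians there coincide and the
  \<open>\<sigma> m j\<close> sum to zero; the transport part is the differentiated flux
  condition.\<close>

lemma speed_J_sum:
  assumes "u \<in> \<Omega>u"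
  shows "(\<Sum>l=1..N+N'. speed j \<epsilon> l *\<^sub>R J u l) = \<epsilon> *\<^sub>R jacobian (F j) (at u)"
proof -
  let ?c = "(\<epsilon> * \<mu> + \<theta> * sqrt (real N'))" and ?X = "(1 / (real N' * \<theta>\<^sup>2)) *\<^sub>R jacobian B (at u)"
  have "(\<Sum>m=1..N'. speed j \<epsilon> (N + m) *\<^sub>R J u (N + m)) = (\<Sum>m=1..N'. (\<sigma> m j * ?c) *\<^sub>R ?X)"
    by (rule sum.cong) (auto simp: speed_def J_diffusive assms)
  also have "\<dots> = ((\<Sum>m=1..N'. \<sigma> m j) * ?c) *\<^sub>R ?X"
    by (simp only: scaleR_left.sum sum_distrib_right)
  also have "\<dots> = 0" by (simp only: sigma_sum mult_zero_left scaleR_zero_left)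
  finally show ?thesis
    by (simp add: sum_split F_derivative[OF assms] speed_def scaleR_sum_right del: One_nat_def)
qed

section \<open>The blocks of \<open>A j\<close>\<close>

lemma kinetic_P_eq: "kinetic_P N N' \<theta> B M e u = P_mat (J u)"
  by (simp add: kinetic_P_def P_mat_def block_mat_def Let_def J_def cong: if_cong)

lemma kinetic_At_eq:
  "kinetic_At N N' lam \<sigma> \<mu> \<theta> e j \<epsilon> = diag_mat (\<lambda>l. speed j \<epsilon> l *\<^sub>R (mat 1 :: real^'k^'k))"
proof -
  \<comment> \<open>Block number and position together determine the index, so the scalar diagonal
    matrix is block diagonal with scalar blocks.\<close>
  have "i = i' \<longleftrightarrow> block_no e i = block_no e i' \<and> block_pos i = block_pos i'" for i i' :: "'k + 'r \<times> 'k"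
    by (cases i; cases i') (auto simp: block_no_def block_pos_def)
  then show ?thesis
    by (auto simp: kinetic_At_def diag_mat_def block_mat_def vec_eq_iff mat_def speed_def Let_def)
qed

lemma
  assumes "u \<in> \<Omega>u"
  shows invertible_kinetic_P: "invertible (kinetic_P N N' \<theta> B M e u)"
    and matrix_inv_kinetic_P: "matrix_inv (kinetic_P N N' \<theta> B M e u) = Pinv_mat (J u)"
  using invertible_P[OF J_sum[OF assms]] matrix_inv_P[OF J_sum[OF assms]]
  by (simp_all add: kinetic_P_eq)

lemma A_eq:
  assumes "upart U \<in> \<Omega>u"
  shows "A j U \<epsilon> = P_mat (J (upart U)) ** diag_mat (\<lambda>l. speed j \<epsilon> l *\<^sub>R mat 1) ** Pinv_mat (J (upart U))"
  by (simp add: kinetic_A_def Let_def matrix_inv_kinetic_P[OF assms] kinetic_At_eq)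
    (simp add: kinetic_P_eq)

lemma A_mult:
  assumes "upart U \<in> \<Omega>u"
  shows "A j U \<epsilon> *v x =
    P_mat (J (upart U)) *v (diag_mat (\<lambda>l. speed j \<epsilon> l *\<^sub>R mat 1) *v (Pinv_mat (J (upart U)) *v x))"
  by (simp add: A_eq[OF assms] matrix_vector_mul_assoc matrix_mul_assoc)

text \<open>\<open>Pinv_mat\<close> sends \<open>(v, 0)\<close> to the tuple of all
  \<open>J l v\<close>; after scaling, the sum formed by \<open>P_mat\<close> is the moment from
  \<open>speed_J_sum\<close>.\<close>

lemma A_state:
  assumes "upart U \<in> \<Omega>u"
  shows "A j U \<epsilon> *v state v 0 = stack e (\<lambda>l. if l = 1 then \<epsilon> *\<^sub>R (jacobian (F j) (at (upart U)) *v v)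
     else speed j \<epsilon> l *\<^sub>R (J (upart U) l *v v) - J (upart U) l *v (\<epsilon> *\<^sub>R (jacobian (F j) (at (upart U)) *v v)))"
proof -
  have "(\<Sum>l=1..N+N'. speed j \<epsilon> l *\<^sub>R (J (upart U) l *v v)) = \<epsilon> *\<^sub>R (jacobian (F j) (at (upart U)) *v v)"
    using arg_cong[OF speed_J_sum[OF assms, of j \<epsilon>], of "\<lambda>X. X *v v"]
    by (simp add: matrix_sum_vector_mult scaleR_mat_mult)
  then show ?thesis
    by (simp add: A_mult[OF assms] Pinv_mat_state diag_mat_stack P_mat_stack scaleR_mat_mult
        del: One_nat_def cong: if_cong)
qed

text \<open>Linear in \<open>\<epsilon>\<close> and independent of \<open>w\<close>: this yields
  criterion (v) and settles both terms of the limit equation that differentiate this block.\<close>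

lemma block11_A:
  assumes "upart U \<in> \<Omega>u"
  shows "block11 (A j U \<epsilon>) = \<epsilon> *\<^sub>R jacobian (F j) (at (upart U))"
  by (simp add: matrix_eq block11_mult A_state[OF assms] scaleR_mat_mult)

lemma block21_A:
  assumes "u \<in> \<Omega>u"
  shows "(block21 (A j (state u 0) 0) *v v) $ i = (speed j 0 (e (fst i)) *\<^sub>R (J u (e (fst i)) *v v)) $ snd i"
  using assms by (simp add: block21_mult A_state)

lemma block12_A:
  assumes "u \<in> \<Omega>u"
  shows "block12 (A j (state u 0) 0) *v w = (\<Sum>r\<in>UNIV. speed j 0 (e r) *\<^sub>R (\<chi> k. w $ (r, k)))"
proof -
  \<comment> \<open>Since \<open>N \<ge> 1\<close>, block \<open>1\<close> is a transport block; its
    speed vanishes at \<open>\<epsilon> = 0\<close>, which removes the first block of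
    \<open>Pinv_mat\<close> applied to \<open>(0, w)\<close>.\<close>
  have "speed j 0 1 = 0" using N by (simp add: speed_def)
  then show ?thesis using assms
    by (simp add: block12_mult A_mult Pinv_mat_state diag_mat_stack P_mat_stack scaleR_mat_mult
        sum_blocks del: One_nat_def)
qed

subsection \<open>Equivalence with the first-order system\<close>

lemma kinetic_U_eq:
  "kinetic_U N N' \<theta> B M e f = stack e (\<lambda>l. if l = 1 then \<Sum>m=1..N+N'. f m
      else f l - Mx l (\<Sum>m=1..N+N'. f m))"
  by (auto simp: kinetic_U_def Let_def vec_eq_iff state_def stack_def block_no_def block_pos_def
      split: sum.split)

text \<open>\<open>P_mat\<close> is the Jacobian of the nonlinear change of variables from
  \<open>f\<close> to \<open>U\<close>, by the chain rule through the Maxwellians.\<close>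

lemma kinetic_U_derivative:
  fixes f :: "nat \<Rightarrow> 'z::real_normed_vector \<Rightarrow> real^'k"
  assumes f: "\<And>l. l \<in> {1..N+N'} \<Longrightarrow> (f l has_derivative f' l) (at z)"
    and u: "(\<Sum>l=1..N+N'. f l z) \<in> \<Omega>u"
  shows "((\<lambda>y. kinetic_U N N' \<theta> B M e (\<lambda>l. f l y)) has_derivative
    (\<lambda>h. P_mat (J (\<Sum>l=1..N+N'. f l z)) *v stack e (\<lambda>l. f' l h))) (at z)"
  unfolding kinetic_U_eq P_mat_stack
proof (rule has_derivative_stack)
  fix l assume l: "l \<in> {1..N+N'}"
  have s: "((\<lambda>y. \<Sum>m=1..N+N'. f m y) has_derivative (\<lambda>h. \<Sum>m=1..N+N'. f' m h)) (at z)"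
    using f by (intro has_derivative_sum)
  note has_derivative_compose[OF s Mx_derivative[OF l u]]
  with f[OF l] s show "((\<lambda>y. if l = 1 then \<Sum>m=1..N+N'. f m y else f l y - Mx l (\<Sum>m=1..N+N'. f m y))
      has_derivative (\<lambda>h. if l = 1 then \<Sum>m=1..N+N'. f' m h
        else f' l h - J (\<Sum>l=1..N+N'. f l z) l *v (\<Sum>m=1..N+N'. f' m h))) (at z)"
    by (cases "l = 1") (auto intro!: has_derivative_diff simp del: One_nat_def)
qed

text \<open>Dividing \<open>speed\<close> by \<open>\<epsilon>\<close> restores the velocities of
  the model, so both families of equations take one form.\<close>

lemma kinetic_model_iff:
  assumes "\<epsilon> \<noteq> 0"
  shows "kinetic_model N N' lam \<sigma> \<mu> \<theta> B M \<epsilon> f z \<longleftrightarrow>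
    (\<forall>l\<in>{1..N+N'}. dt (f l) z + (1 / \<epsilon>) *\<^sub>R (\<Sum>j\<in>UNIV. speed j \<epsilon> l *\<^sub>R dx j (f l) z)
       = (1 / \<epsilon>\<^sup>2) *\<^sub>R (Mx l (\<Sum>l=1..N+N'. f l z) - f l z))"
proof -
  have "speed j \<epsilon> l / \<epsilon> = lam l j" if "l \<in> {1..N}" for j l
    using that assms by (simp add: speed_def)
  moreover have "speed j \<epsilon> (N + m) / \<epsilon> = (\<mu> + \<theta> * sqrt (real N') / \<epsilon>) * \<sigma> m j" if "m \<in> {1..N'}" for j m
    using that assms by (simp add: speed_def field_simps)
  ultimately show ?thesis
    by (simp add: kinetic_model_def Let_def ball_split scaleR_sum_right Mx_simps del: One_nat_def)
qed

text \<open>Derivatives of \<open>U\<close> are \<open>P\<close> applied to derivatives of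
  \<open>f\<close>, and \<open>A j\<close> undoes \<open>P\<close> before scaling by the speeds. The
  first-order system is thus \<open>P\<close> times the kinetic system, and \<open>P\<close> is
  invertible.\<close>

lemma kinetic_model_first_order:
  fixes f :: "nat \<Rightarrow> (real^'d) \<times> real \<Rightarrow> real^'k"
  assumes "\<epsilon> > 0" and f: "\<And>l. l \<in> {1..N+N'} \<Longrightarrow> f l differentiable (at z)"
    and u: "(\<Sum>l=1..N+N'. f l z) \<in> \<Omega>u"
  shows "kinetic_model N N' lam \<sigma> \<mu> \<theta> B M \<epsilon> f z \<longleftrightarrow>
    first_order_equation A kinetic_Q \<epsilon> (\<lambda>y. kinetic_U N N' \<theta> B M e (\<lambda>l. f l y)) z"
proof -
  define u where "u = (\<Sum>l=1..N+N'. f l z)"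
  let ?U = "\<lambda>y. kinetic_U N N' \<theta> B M e (\<lambda>l. f l y)"
  let ?P = "P_mat (J u)"
  have u': "u \<in> \<Omega>u" using u by (simp add: u_def)
  have Uz: "?U z = stack e (\<lambda>l. if l = 1 then u else f l z - Mx l u)"
    by (simp add: kinetic_U_eq u_def cong: if_cong)
  have f': "(f l has_derivative frechet_derivative (f l) (at z)) (at z)" if "l \<in> {1..N+N'}" for l
    using f[OF that] frechet_derivative_works by blast
  have U': "(?U has_derivative (\<lambda>h. ?P *v stack e (\<lambda>l. frechet_derivative (f l) (at z) h))) (at z)"
    unfolding u_def by (rule kinetic_U_derivative[OF f' u])
  have dt: "dt ?U z = ?P *v stack e (\<lambda>l. dt (f l) z)"
    unfolding dt_eq[OF U']
    by (rule arg_cong[of _ _ "(*v) ?P"]) (simp add: stack_eq_iff dt_eq[OF f'])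
  have dx: "dx j ?U z = ?P *v stack e (\<lambda>l. dx j (f l) z)" for j
    unfolding dx_eq[OF U']
    by (rule arg_cong[of _ _ "(*v) ?P"]) (simp add: stack_eq_iff dx_eq[OF f'])
  have Pinv: "Pinv_mat (J u) *v (?P *v x) = x" for x
    by (simp add: matrix_vector_mul_assoc Pinv_P[OF J_sum[OF u']])
  have PPinv: "?P *v (Pinv_mat (J u) *v x) = x" for x
    by (simp add: matrix_vector_mul_assoc P_Pinv[OF J_sum[OF u']])
  have P_eq_iff: "?P *v x = y \<longleftrightarrow> x = Pinv_mat (J u) *v y" for x y
    using Pinv[of x] PPinv[of y] by auto
  have A: "A j (?U z) \<epsilon> *v dx j ?U z = ?P *v stack e (\<lambda>l. speed j \<epsilon> l *\<^sub>R dx j (f l) z)" for j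
    using A_mult[of "?U z" j \<epsilon>] u'
    by (simp add: Uz dx Pinv diag_mat_stack scaleR_mat_mult)
  have Q: "Pinv_mat (J u) *v kinetic_Q (?U z) \<epsilon> = stack e (\<lambda>l. Mx l u - f l z)"
  proof -
    have "kinetic_Q (?U z) \<epsilon> = stack e (\<lambda>l. if l = 1 then 0 else Mx l u - f l z)"
      by (auto simp: Uz kinetic_Q_def vec_eq_iff state_def stack_def block_no_def block_pos_def wpart_def
          split: sum.split)
    \<comment> \<open>The Maxwellians and the \<open>f l\<close> have the same sum \<open>u\<close>.
      This recovers the relaxation term of the first block, which is not a component of
      \<open>w\<close>.\<close>
    moreover have "- (\<Sum>r\<in>UNIV. Mx (e r) u - f (e r) z) = Mx 1 u - f 1 z"
      using Mx_sum[OF u'] u_def by (simp add: sum_blocks sum_subtractf algebra_simps del: One_nat_def)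
    ultimately show ?thesis
      by (simp add: Pinv_mat_stack stack_eq_iff del: One_nat_def)
  qed
  have "first_order_equation A kinetic_Q \<epsilon> ?U z \<longleftrightarrow>
     ?P *v stack e (\<lambda>l. dt (f l) z + (1 / \<epsilon>) *\<^sub>R (\<Sum>j\<in>UNIV. speed j \<epsilon> l *\<^sub>R dx j (f l) z))
       = (1 / \<epsilon>\<^sup>2) *\<^sub>R kinetic_Q (?U z) \<epsilon>"
    by (simp add: first_order_equation_def A dt flip: matrix_vector_mult_sum matrix_vector_mult_scaleR
        matrix_vector_right_distrib stack_sum stack_scaleR stack_add)
  also have "\<dots> \<longleftrightarrow> stack e (\<lambda>l. dt (f l) z + (1 / \<epsilon>) *\<^sub>R (\<Sum>j\<in>UNIV. speed j \<epsilon> l *\<^sub>R dx j (f l) z))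
       = (1 / \<epsilon>\<^sup>2) *\<^sub>R (Pinv_mat (J u) *v kinetic_Q (?U z) \<epsilon>)"
    unfolding P_eq_iff matrix_vector_mult_scaleR ..
  also have "\<dots> \<longleftrightarrow> kinetic_model N N' lam \<sigma> \<mu> \<theta> B M \<epsilon> f z"
    unfolding Q stack_scaleR stack_eq_iff
    using \<open>\<epsilon> > 0\<close> kinetic_model_iff[of \<epsilon> f z, folded u_def] by simp
  finally show ?thesis by blast
qed

end

subsection \<open>The convergence criteria\<close>

lemma upart_kinetic_Q [simp]: "upart (kinetic_Q U \<epsilon>) = 0"
  by (simp add: kinetic_Q_def upart_def state_def vec_eq_iff)

lemma wpart_kinetic_Q [simp]: "wpart (kinetic_Q U \<epsilon>) = - wpart U"
  by (simp add: kinetic_Q_def wpart_def state_def vec_eq_iff)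

lemma kinetic_Q_matrix: "kinetic_Q U \<epsilon> = - lower_block (mat 1) *v U"
  using lower_block_mult[of "mat 1" "upart U" "wpart U"]
  by (simp add: kinetic_Q_def matrix_vector_mult_uminus)

lemma dq_dw_kinetic_Q: "dq_dw kinetic_Q u = - mat 1"
  unfolding dq_dw_def
  by (rule jacobian_eqI) (auto intro!: derivative_eq_intros simp: matrix_vector_mult_uminus)

lemma jacobian_kinetic_Q: "jacobian (\<lambda>U. kinetic_Q U 0) (at U) = - lower_block (mat 1)"
  unfolding kinetic_Q_matrix
  by (rule jacobian_eqI) (intro bounded_linear_imp_has_derivative matrix_vector_mul_bounded_linear)

lemma invertible_uminus_mat_1: "invertible (- mat 1 :: real^'n^'n)"
  unfolding invertible_def
  by (rule exI[of _ "- mat 1"]) (simp add: matrix_eq matrix_vector_mul_assoc[symmetric] matrix_vector_mult_uminus)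

lemma matrix_inv_uminus_mat_1: "matrix_inv (- mat 1) *v x = - (x :: real^'n)"
proof -
  have "(- mat 1) *v (matrix_inv (- mat 1) *v x) = x"
    by (simp only: matrix_vector_mul_assoc matrix_inv_mult[OF invertible_uminus_mat_1] matrix_vector_mul_lid)
  then show ?thesis by (simp add: matrix_vector_mult_uminus equation_minus_iff)
qed

lemma kinetic_Q_bounded_linear: "bounded_linear (\<lambda>z. kinetic_Q (fst z) (snd z))"
  unfolding kinetic_Q_matrix
  by (rule bounded_linear_compose[OF matrix_vector_mul_bounded_linear bounded_linear_fst])

lemma sym_pos_def_scaleR: "c > 0 \<Longrightarrow> sym_pos_def A \<Longrightarrow> sym_pos_def (c *\<^sub>R A)"
  by (simp add: sym_pos_def_def scaleR_mat_mult transpose_scalar)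

text \<open>\<open>DQ\<close> maps \<open>(u, w)\<close> to \<open>(0, -w)\<close>, so by symmetry
  of \<open>H\<close> the form on the left is \<open>-2\<close> times the product of
  \<open>(0, w)\<close> with \<open>H (u, w)\<close>. Decoupling removes the contribution of
  \<open>u\<close> and leaves the lower block \<open>S\<close> of \<open>H\<close>.\<close>

lemma damping_estimate:
  fixes H :: "real^('p::finite + 'q::finite)^('p + 'q)"
  assumes H: "sym_pos_def H" and decoupled: "\<And>u w. state 0 w \<bullet> (H *v state u 0) = 0"
  defines "S \<equiv> (\<chi> i j. H $ Inr i $ Inr j) :: real^'q^'q" and "DQ \<equiv> - lower_block (mat 1)"
  shows "sym_pos_def S \<and> matrix_le (H ** DQ + transpose DQ ** H) (- lower_block S)"
proof -
  have S: "S *v w = wpart (H *v state 0 w)" for w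
    by (simp add: vec_eq_iff wpart_def S_def state_def matrix_vector_mult_def
        UNIV_Plus_UNIV[symmetric] sum.Plus del: UNIV_Plus_UNIV)
  have wS: "w \<bullet> (S *v w) = state 0 w \<bullet> (H *v state 0 w)" for w
    using inner_state[of 0 w "upart (H *v state 0 w)" "wpart (H *v state 0 w)"] by (simp add: S)
  have pos: "w \<bullet> (S *v w) > 0" if "w \<noteq> 0" for w
  proof -
    have "state (0 :: real^'p) w \<noteq> 0" using that wpart_state[of "0 :: real^'p" w] linear_0[OF linear_wpart] by metis
    then show ?thesis using H by (simp add: wS sym_pos_def_def)
  qed
  have "transpose H $ Inr i $ Inr j = H $ Inr i $ Inr j" for i j
    using H by (simp add: sym_pos_def_def)
  then have "transpose S = S" by (simp add: S_def vec_eq_iff transpose_def)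
  with pos have "sym_pos_def S" by (simp add: sym_pos_def_def)
  moreover have "v \<bullet> ((H ** DQ + transpose DQ ** H) *v v) \<le> v \<bullet> (- lower_block S *v v)" for v
  proof -
    define w where "w = wpart v"
    have DQ: "DQ *v v = - state 0 w"
      using lower_block_mult[of "mat 1" "upart v" w]
      by (simp add: DQ_def matrix_vector_mult_uminus w_def)
    have "v \<bullet> ((H ** DQ + transpose DQ ** H) *v v) = v \<bullet> (H *v (DQ *v v)) + (DQ *v v) \<bullet> (H *v v)"
      by (simp add: matrix_vector_mult_add_rdistrib inner_add_right matrix_vector_mul_assoc[symmetric]
          dot_transpose_mult del: transpose_matrix_vector)
    also have "\<dots> = - 2 * (state 0 w \<bullet> (H *v v))"
      unfolding sym_pos_defD[OF H, of v] DQ by (simp add: inner_commute)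
    also have "H *v v = H *v state (upart v) 0 + H *v state 0 w"
      using matrix_vector_right_distrib[of H "state (upart v) 0" "state 0 w"]
      by (simp add: state_add w_def)
    also have "state 0 w \<bullet> (\<dots>) = w \<bullet> (S *v w)"
      by (simp add: inner_add_right decoupled wS)
    \<comment> \<open>Positivity of \<open>S\<close> allows half of the damping to be given
      up.\<close>
    also have "- 2 * \<dots> \<le> - (w \<bullet> (S *v w))"
      using pos[of w] by (cases "w = 0") auto
    also have "- (w \<bullet> (S *v w)) = v \<bullet> (- lower_block S *v v)"
      using lower_block_mult[of S "upart v" w] inner_state[of "upart v" w 0 "S *v w"]
      by (simp add: matrix_vector_mult_uminus w_def)
    finally show ?thesis .
  qed
  ultimately show ?thesis by (simp add: matrix_le_def)
qed

context kinetic_system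
begin

text \<open>With the inverse of \<open>P\<close> explicit, \<open>A j\<close> is a product of
  matrices built from the \<open>J l\<close> and the speeds. The formula holds for every real
  \<open>\<epsilon>\<close>, which supplies the open neighbourhood wanted by
  \<open>smooth_on\<close>.\<close>

lemma Ck_on_A:
  "Ck_on n (\<lambda>z. A j (fst z) (snd z)) ((\<lambda>z. upart (fst z)) -` \<Omega>u)"
proof -
  let ?h = "\<lambda>z. upart (fst z) :: real^'k" and ?T = "(\<lambda>z. upart (fst z)) -` \<Omega>u :: ((real^('k + 'r \<times> 'k)) \<times> real) set"
  have h: "bounded_linear (?h :: (real^('k + 'r \<times> 'k)) \<times> real \<Rightarrow> real^'k)"
    by (intro bounded_linear_compose[OF _ bounded_linear_fst] linear_conv_bounded_linear[THEN iffD1] linear_upart)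
  have op: "open ?T"
    by (rule open_vimage[OF open_\<Omega>u linear_continuous_on[OF h]])
  have "Ck_on n (\<lambda>z. diag_mat (\<lambda>l. speed j (snd z) l *\<^sub>R (mat 1 :: real^'k^'k))) ?T"
    unfolding diag_mat_def
  proof (rule Ck_on_block_mat[OF op])
    fix l m
    \<comment> \<open>Every speed is affine in \<open>\<epsilon>\<close>.\<close>
    obtain p q where pq: "\<And>\<epsilon>. speed j \<epsilon> l = \<epsilon> * p + q"
    proof (cases "l \<le> N")
      case True
      then show ?thesis using that[of "lam l j" 0] by (simp add: speed_def)
    next
      case False
      then show ?thesis
        using that[of "\<sigma> (l - N) j * \<mu>" "\<sigma> (l - N) j * (\<theta> * sqrt (real N'))"]
        by (simp add: speed_def algebra_simps)
    qed
    have "bounded_linear (\<lambda>z :: (real^('k + 'r \<times> 'k)) \<times> real. (snd z * p) *\<^sub>R X)" for X :: "real^'k^'k"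
      by (intro bounded_linear_compose[OF bounded_linear_scaleR_left]
          bounded_linear_compose[OF bounded_linear_mult_left bounded_linear_snd])
    then show "Ck_on n (\<lambda>z. if l = m then speed j (snd z) l *\<^sub>R (mat 1 :: real^'k^'k) else 0) ?T"
      unfolding pq scaleR_left_distrib
      by (cases "l = m") (simp_all add: Ck_on_const[OF op] Ck_on_add[OF op] Ck_on_bounded_linear[OF op])
  qed
  then have "Ck_on n (\<lambda>z. P_mat (J (?h z)) ** diag_mat (\<lambda>l. speed j (snd z) l *\<^sub>R mat 1)
      ** Pinv_mat (J (?h z))) ?T"
    using Ck_on_comp_linear[OF open_\<Omega>u h Ck_on_P_mat[OF open_\<Omega>u Ck_on_J]]
      Ck_on_comp_linear[OF open_\<Omega>u h Ck_on_Pinv_mat[OF open_\<Omega>u Ck_on_J]]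
    by (intro Ck_on_bilinear[OF op bounded_bilinear_matrix_mult])
  then show ?thesis
    by (subst Ck_on_cong[OF op]) (auto simp: A_eq)
qed

lemma smooth_coefficients_kinetic:
  assumes "\<And>U. U \<in> \<Omega> \<Longrightarrow> upart U \<in> \<Omega>u"
  shows "smooth_coefficients \<Omega> A kinetic_Q"
proof -
  have h: "bounded_linear (\<lambda>z. upart (fst z) :: real^'k)"
    by (intro bounded_linear_compose[OF _ bounded_linear_fst] linear_conv_bounded_linear[THEN iffD1] linear_upart)
  have "smooth_on (\<Omega> \<times> {0..1}) (\<lambda>z. A j (fst z) (snd z))" for j
    by (rule smooth_on_openI[OF open_vimage[OF open_\<Omega>u linear_continuous_on[OF h]] _ Ck_on_A])
      (use assms in auto)
  then show ?thesis
    using smooth_on_linear[OF kinetic_Q_bounded_linear]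
    by (simp add: smooth_coefficients_def case_prod_unfold)
qed

lemma criterion_i_kinetic: "criterion_i \<Omega> (kinetic_Q :: real^('k + 'r \<times> 'k) \<Rightarrow> real \<Rightarrow> real^('k + 'r \<times> 'k))"
proof -
  have "bounded_linear (\<lambda>z. wpart (kinetic_Q (fst z) (snd z)) :: real^('r \<times> 'k))"
    by (intro bounded_linear_compose[OF _ kinetic_Q_bounded_linear]
        linear_conv_bounded_linear[THEN iffD1] linear_wpart)
  then have "smooth_on (\<Omega> \<times> {0..1}) (\<lambda>z. wpart (kinetic_Q (fst z) (snd z)) :: real^('r \<times> 'k))"
    by (rule smooth_on_linear)
  then show ?thesis by (simp add: criterion_i_def case_prod_unfold)
qed

lemma criterion_ii_kinetic: "criterion_ii \<Omega>u \<Omega> kinetic_Q"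
  by (simp add: criterion_ii_def dq_dw_kinetic_Q invertible_uminus_mat_1)

text \<open>At \<open>\<epsilon> = 0\<close> the upper left block vanishes throughout the open set
  \<open>\<Omega>u\<close>, hence so does its derivative.\<close>

lemma criterion_v_kinetic: "criterion_v \<Omega>u A"
  unfolding criterion_v_def
proof (intro ballI allI conjI)
  fix u j assume u: "u \<in> \<Omega>u"
  then show "block11 (A j (state u 0) 0) = 0" by (simp add: block11_A)
  show "((\<lambda>u'. block11 (A j (state u' 0) 0)) has_derivative (\<lambda>_. 0)) (at u)"
    by (rule has_derivative_transform_within_open[OF has_derivative_const[of 0] open_\<Omega>u u])
      (simp add: block11_A)
qed

text \<open>The eigenbasis gives one \<open>G\<close> for the Jacobians of \<open>B\<close> and all
  \<open>M l\<close>. A diffusive block is \<open>c\<close> times the Jacobian of \<open>B\<close>,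
  so its \<open>D\<close> is divided by \<open>c\<close> to keep the same \<open>G\<close>.\<close>

lemma block_symmetrizers:
  assumes u: "u \<in> \<Omega>u"
    and posB: "positive_eigenvalues (jacobian B (at u))"
    and posM: "\<And>l. l \<in> {1..N} \<Longrightarrow> positive_eigenvalues (jacobian (M l) (at u))"
    and basis: "common_eigenbasis \<A>"
    and sub: "(\<lambda>l. jacobian (M l) (at u)) ` {1..N} \<union> {jacobian B (at u)} \<subseteq> \<A>"
  shows "\<exists>D G. \<forall>l\<in>{1..N+N'}. sym_pos_def (D l) \<and> D l ** J u l = G"
proof -
  let ?\<P> = "(\<lambda>l. jacobian (M l) (at u)) ` {1..N} \<union> {jacobian B (at u)}"
  have "positive_eigenvalues X" if "X \<in> ?\<P>" for X using that posB posM by auto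
  then obtain G where G: "\<And>X. X \<in> ?\<P> \<Longrightarrow> \<exists>D. sym_pos_def D \<and> D ** X = G"
    by (rule common_eigenbasis_symmetrizer[OF basis sub]) blast+
  have "\<exists>D. sym_pos_def D \<and> D ** J u l = G" if l: "l \<in> {1..N+N'}" for l
  proof (cases "l \<le> N")
    case True
    then have "J u l = jacobian (M l) (at u)" by (simp add: J_def Mx_simps)
    then show ?thesis using G[of "J u l"] True l by auto
  next
    case False
    define c where "c = 1 / (real N' * \<theta>\<^sup>2)"
    have c: "c > 0" using theta N' by (simp add: c_def)
    have "l = N + (l - N)" "1 \<le> l - N" using False by auto
    then have Jl: "J u l = c *\<^sub>R jacobian B (at u)" using J_diffusive[OF _ u, of "l - N"] by (simp add: c_def)
    obtain D where D: "sym_pos_def D" "D ** jacobian B (at u) = G" using G by blast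
    have "sym_pos_def ((1 / c) *\<^sub>R D)" using c D(1) by (intro sym_pos_def_scaleR) auto
    moreover have "((1 / c) *\<^sub>R D) ** J u l = G"
      using c by (simp add: Jl D(2)[symmetric] matrix_eq matrix_vector_mul_assoc[symmetric] scaleR_mat_mult
          matrix_vector_mult_scaleR)
    ultimately show ?thesis by blast
  qed
  then show ?thesis by metis
qed

text \<open>Congruence by the inverse of \<open>P\<close> reduces symmetrization to commuting block
  diagonal matrices. The common value \<open>G u\<close> decouples \<open>u\<close> from
  \<open>w\<close>, so \<open>damping_estimate\<close> gives criterion (iv).\<close>

lemma symmetrizer_kinetic:
  assumes D: "\<And>u l. u \<in> \<Omega>u \<Longrightarrow> l \<in> {1..N+N'} \<Longrightarrow> sym_pos_def (D u l) \<and> D u l ** J u l = G u"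
    and \<Omega>: "\<And>U. U \<in> \<Omega> \<Longrightarrow> upart U \<in> \<Omega>u"
  defines "A0 \<equiv> \<lambda>U (_::real). transpose (Pinv_mat (J (upart U))) ** diag_mat (D (upart U)) ** Pinv_mat (J (upart U))"
  shows "criterion_iii \<Omega> A A0" "criterion_iv \<Omega>u kinetic_Q A0"
proof -
  have pos: "sym_pos_def (A0 U \<epsilon>)" if U: "upart U \<in> \<Omega>u" for U \<epsilon>
  proof -
    have "invertible (Pinv_mat (J (upart U)))"
      using Pinv_P[OF J_sum[OF U]] P_Pinv[OF J_sum[OF U]] by (auto simp: invertible_def)
    then show ?thesis unfolding A0_def using D[OF U]
      by (intro sym_pos_def_congruence sym_pos_def_diag_mat) auto
  qed
  have "A0 U \<epsilon> ** A j U \<epsilon> = transpose (A j U \<epsilon>) ** A0 U \<epsilon>" if "U \<in> \<Omega>" for U \<epsilon> j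
  proof -
    have U: "upart U \<in> \<Omega>u" by (rule \<Omega>[OF that])
    let ?Pi = "Pinv_mat (J (upart U))" and ?P = "P_mat (J (upart U))" and ?D = "diag_mat (D (upart U))"
    let ?S = "diag_mat (\<lambda>l. speed j \<epsilon> l *\<^sub>R (mat 1 :: real^'k^'k))"
    have PiP: "?Pi ** ?P = mat 1" by (rule Pinv_P[OF J_sum[OF U]])
    then have PiP': "transpose ?P ** transpose ?Pi = mat 1"
      by (metis matrix_transpose_mul transpose_mat)
    have S: "transpose ?S = ?S" by (rule transpose_diag_mat) (simp add: transpose_scalar transpose_mat)
    \<comment> \<open>The blocks of \<open>?S\<close> are scalar multiples of the identity and
      commute with any block of \<open>?D\<close>.\<close>
    have comm: "?D ** ?S = ?S ** ?D"
      by (rule matrix_eq_stackI) (simp add: matrix_vector_mul_assoc[symmetric] diag_mat_stack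
          scaleR_mat_mult matrix_vector_mult_scaleR)
    have "A0 U \<epsilon> ** A j U \<epsilon> = transpose ?Pi ** ?D ** (?Pi ** ?P) ** ?S ** ?Pi"
      by (simp only: A0_def A_eq[OF U] matrix_mul_assoc)
    also have "\<dots> = transpose ?Pi ** (?D ** ?S) ** ?Pi"
      by (simp only: PiP matrix_mul_rid matrix_mul_assoc)
    \<comment> \<open>After the swap, the identity is inserted as
      \<open>transpose ?P ** transpose ?Pi\<close> to rebuild the transpose of
      \<open>A j\<close>.\<close>
    also have "\<dots> = transpose ?Pi ** ?S ** (transpose ?P ** transpose ?Pi) ** ?D ** ?Pi"
      by (simp only: PiP' comm matrix_mul_rid matrix_mul_assoc)
    also have "\<dots> = transpose (A j U \<epsilon>) ** A0 U \<epsilon>"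
      by (simp only: A0_def A_eq[OF U] matrix_transpose_mul S matrix_mul_assoc)
    finally show ?thesis .
  qed
  then show "criterion_iii \<Omega> A A0" using pos \<Omega> by (auto simp: criterion_iii_def)
  have "\<exists>S. sym_pos_def S \<and> (let DQ = jacobian (\<lambda>U. kinetic_Q U 0) (at (state u 0)); H = A0 (state u 0) 0 in
      matrix_le (H ** DQ + transpose DQ ** H) (- lower_block S))" if u: "u \<in> \<Omega>u" for u
  proof -
    have "state 0 w \<bullet> (A0 (state u 0) 0 *v state v 0) = 0" for w v
      unfolding A0_def upart_state by (rule symmetrizer_decoupled) (use D[OF u] in auto)
    with pos[of "state u 0"] u show ?thesis
      unfolding Let_def jacobian_kinetic_Q by (intro exI) (rule damping_estimate, auto)
  qed
  then show "criterion_iv \<Omega>u kinetic_Q A0" unfolding criterion_iv_def by metis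
qed

end

subsection \<open>The limit equation\<close>

text \<open>Differentiability is asked in space only, at the fixed time \<open>snd z\<close>,
  because \<open>C21_on\<close> does not provide joint differentiability in space and time.\<close>

lemma dx_slice:
  assumes "((\<lambda>x. h (x, snd z)) has_derivative h') (at (fst z))"
  shows "dx j h z = h' (axis j 1)"
proof -
  have "((\<lambda>s. fst z + s *\<^sub>R axis j 1) has_derivative (\<lambda>s. s *\<^sub>R axis j 1)) (at 0)"
    by (auto intro!: derivative_eq_intros)
  from has_derivative_compose[OF this, of "\<lambda>x. h (x, snd z)" h'] assms
  have "((\<lambda>s. h (fst z + s *\<^sub>R axis j 1, snd z)) has_derivative (\<lambda>s. h' (s *\<^sub>R axis j 1))) (at 0)"
    by simp
  moreover have "(\<lambda>s. h' (s *\<^sub>R axis j 1)) = (\<lambda>s. s *\<^sub>R h' (axis j 1))"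
    using linear_scale[OF has_derivative_linear[OF assms], of _ "axis j 1"] by (rule ext)
  ultimately have "((\<lambda>s. h (fst z + s *\<^sub>R axis j 1, snd z)) has_vector_derivative h' (axis j 1)) (at 0)"
    by (simp only: has_vector_derivative_def)
  then show ?thesis by (simp add: dx_def vector_derivative_at)
qed

lemma open_slice: "open D \<Longrightarrow> open {x. (x, t) \<in> D}"
  by (rule open_vimage[of D "\<lambda>x. (x, t)", unfolded vimage_def]) (auto intro!: continuous_intros)

text \<open>The formula for \<open>limit_w1\<close> is available only inside \<open>D\<close> but is
  differentiated again; agreement on an open set suffices.\<close>

lemma dx_cong:
  assumes "open D" "z \<in> D" "\<And>y. y \<in> D \<Longrightarrow> h y = k y"
  shows "dx j h z = dx j k z"
proof -
  let ?S = "{s. (fst z + s *\<^sub>R axis j 1, snd z) \<in> D}"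
  have "open ?S"
    by (rule open_vimage[OF assms(1), of "\<lambda>s. (fst z + s *\<^sub>R axis j 1, snd z)", unfolded vimage_def])
      (auto intro!: continuous_intros)
  moreover have "0 \<in> ?S" using assms(2) by simp
  ultimately have "eventually (\<lambda>s. s \<in> ?S) (nhds 0)" by (rule eventually_nhds_in_open)
  then show ?thesis
    unfolding dx_def
    by (intro vector_derivative_cong_eq) (auto elim!: eventually_mono simp: assms(3))
qed

text \<open>\<open>Q\<close> does not depend on \<open>\<epsilon>\<close>, and its
  \<open>w\<close>-derivative is minus the identity.\<close>

lemma (in kinetic_system) limit_w1_kinetic:
  assumes "u z \<in> \<Omega>u"
  shows "limit_w1 A kinetic_Q u z = - (\<Sum>j\<in>UNIV. block21 (A j (state (u z) 0) 0) *v dx j u z)"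
proof -
  have "((\<lambda>\<epsilon>. wpart (kinetic_Q (state (u z) 0) \<epsilon>)) has_vector_derivative 0) (at 0 within {0..1})"
    by simp
  then have "vector_derivative (\<lambda>\<epsilon>. wpart (kinetic_Q (state (u z) 0) \<epsilon>)) (at 0 within {0..1::real})
      = (0 :: real^('r \<times> 'k))"
    by (intro vector_derivative_within_closed_interval) auto
  then show ?thesis
    by (simp add: limit_w1_def dq_dw_kinetic_Q matrix_inv_uminus_mat_1)
qed

text \<open>By \<open>block11_A\<close> the \<open>w\<close>-derivative of the upper left block is
  zero and its \<open>\<epsilon>\<close>-derivative is the flux Jacobian.\<close>

lemma (in kinetic_system) limit_equation_kinetic:
  assumes u: "u z \<in> \<Omega>u"
  shows "limit_equation A kinetic_Q u z \<longleftrightarrow>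
     dt u z + (\<Sum>j\<in>UNIV. block12 (A j (state (u z) 0) 0) *v dx j (limit_w1 A kinetic_Q u) z)
       + (\<Sum>j\<in>UNIV. jacobian (F j) (at (u z)) *v dx j u z) = 0"
proof -
  have "vector_derivative (\<lambda>\<epsilon>. block11 (A j (state (u z) 0) \<epsilon>)) (at 0 within {0..1})
      = jacobian (F j) (at (u z))" for j
    unfolding block11_A[of "state (u z) 0", unfolded upart_state, OF u]
    by (rule vector_derivative_within_closed_interval) (auto intro!: derivative_eq_intros)
  moreover have "frechet_derivative (\<lambda>w. block11 (A j (state (u z) w) 0)) (at 0) = (\<lambda>_. 0)" for j
    using u by (simp add: block11_A)
  ultimately show ?thesis
    unfolding limit_equation_def by simp
qed

text \<open>The speed at \<open>\<epsilon> = 0\<close> times the factor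
  \<open>1 / (N' * \<theta>\<^sup>2)\<close> of the diffusive Maxwellian, simplified.\<close>

definition (in kinetic_system) w1_coef :: "'d \<Rightarrow> nat \<Rightarrow> real" where
  "w1_coef i l = (if l \<le> N then 0 else \<sigma> (l - N) i / (\<theta> * sqrt (real N')))"

definition (in kinetic_system) w1_map :: "'d \<Rightarrow> real^'k \<Rightarrow> real^('r \<times> 'k)" where
  "w1_map i v = (\<chi> p. w1_coef i (e (fst p)) * v $ snd p)"

text \<open>At \<open>\<epsilon> = 0\<close> the transport speeds vanish and the diffusive Jacobians
  are multiples of that of \<open>B\<close>, so this block sees only \<open>B\<close>.\<close>

lemma (in kinetic_system) block21_w1_map:
  assumes u: "u \<in> \<Omega>u"
  shows "block21 (A i (state u 0) 0) *v v = w1_map i (jacobian B (at u) *v v)"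
proof -
  have "speed i 0 l *\<^sub>R (J u l *v v) = w1_coef i l *\<^sub>R (jacobian B (at u) *v v)" for l
  proof (cases "l \<le> N")
    case False
    then have l: "l = N + (l - N)" "1 \<le> l - N" by auto
    have "real N' > 0" using N' by simp
    then have "sqrt (real N') / (real N' * \<theta>\<^sup>2) * \<theta> = 1 / (\<theta> * sqrt (real N'))"
      using theta by (simp add: field_simps power2_eq_square)
    moreover have "speed i 0 l * (1 / (real N' * \<theta>\<^sup>2))
        = \<sigma> (l - N) i * (sqrt (real N') / (real N' * \<theta>\<^sup>2) * \<theta>)"
      using False by (simp add: speed_def)
    ultimately have "speed i 0 l * (1 / (real N' * \<theta>\<^sup>2)) = w1_coef i l"
      using False by (simp add: w1_coef_def)
    then show ?thesis
      using J_diffusive[OF l(2) u] l(1) by (simp add: scaleR_mat_mult)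
  qed (simp add: speed_def w1_coef_def)
  then show ?thesis
    by (simp add: vec_eq_iff block21_A[OF u] w1_map_def del: vector_scaleR_component) simp
qed

text \<open>The factors \<open>\<theta> * sqrt N'\<close> cancel, and orthonormality of the
  \<open>\<sigma>\<close> remains.\<close>

lemma (in kinetic_system) speed_w1_coef:
  "(\<Sum>r\<in>UNIV. speed j 0 (e r) * w1_coef i (e r)) = (if i = j then 1 else 0)"
proof -
  have "speed j 0 1 = 0" using N by (simp add: speed_def)
  then have "(\<Sum>r\<in>UNIV. speed j 0 (e r) * w1_coef i (e r)) = (\<Sum>l=1..N+N'. speed j 0 l * w1_coef i l)"
    by (simp add: sum_blocks del: One_nat_def)
  also have "\<dots> = (\<Sum>m=1..N'. speed j 0 (N + m) * w1_coef i (N + m))"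
    by (simp add: sum_split w1_coef_def del: One_nat_def)
  also have "\<dots> = (\<Sum>m=1..N'. \<sigma> m j * \<sigma> m i)"
    using theta N' by (intro sum.cong) (auto simp: speed_def w1_coef_def)
  finally show ?thesis by (simp add: sigma_orth eq_commute[of j i] del: One_nat_def)
qed

text \<open>Orthonormality acts as a Kronecker delta in the double sum over directions; this is why
  no mixed second derivatives survive.\<close>

lemma (in kinetic_system) block12_w1_map:
  assumes u: "u \<in> \<Omega>u"
  shows "(\<Sum>j\<in>UNIV. block12 (A j (state u 0) 0) *v (\<Sum>i\<in>UNIV. w1_map i (v i j))) = (\<Sum>j\<in>UNIV. v j j)"
proof -
  have "block12 (A j (state u 0) 0) *v (\<Sum>i\<in>UNIV. w1_map i (v i j)) = v j j" for j
  proof -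
    have "(\<Sum>r\<in>UNIV. speed j 0 (e r) *\<^sub>R (\<chi> k. (w1_map i x) $ (r, k)))
        = (if i = j then x else 0)" for i x
    proof -
      have "(\<Sum>r\<in>UNIV. speed j 0 (e r) *\<^sub>R (\<chi> k. (w1_map i x) $ (r, k)))
          = (\<Sum>r\<in>UNIV. speed j 0 (e r) * w1_coef i (e r)) *\<^sub>R x"
        by (simp add: vec_eq_iff w1_map_def sum_distrib_right mult.assoc)
      then show ?thesis by (simp add: speed_w1_coef)
    qed
    then have "block12 (A j (state u 0) 0) *v w1_map i x = (if i = j then x else 0)" for i x
      by (simp add: block12_A[OF u])
    then show ?thesis by (simp add: matrix_vector_mult_sum)
  qed
  then show ?thesis by simp
qed

text \<open>Here \<open>w1\<close> is minus the sum of the \<open>w1_map i\<close> applied to the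
  \<open>x_i\<close>-derivatives of \<open>B(u)\<close>. Differentiating once more and contracting
  with \<open>block12\<close> leaves minus the sum of the pure second derivatives of
  \<open>B(u)\<close>.\<close>

lemma (in kinetic_system) limit_equation_parabolic:
  fixes u :: "(real^'d) \<times> real \<Rightarrow> real^'k"
  assumes D: "open D" and uD: "u ` D \<subseteq> \<Omega>u" and C21: "C21_on D u" and z: "z \<in> D"
  shows "limit_equation A kinetic_Q u z \<longleftrightarrow> parabolic_equation F B u z"
proof -
  have u: "u y \<in> \<Omega>u" if "y \<in> D" for y using uD that by auto
  define S where "S t = {x. (x, t) \<in> D}" for t
  have S: "open (S t)" for t unfolding S_def by (rule open_slice[OF D])
  have Su: "Ck_on (Suc 1) (\<lambda>x. u (x, t)) (S t)" for t
    using C21 by (simp add: C21_on_def S_def numeral_2_eq_2)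
  define u' where "u' y = frechet_derivative (\<lambda>x. u (x, snd y)) (at (fst y))" for y
  have u': "((\<lambda>x. u (x, snd y)) has_derivative u' y) (at (fst y))" if "y \<in> D" for y
    unfolding u'_def by (rule Ck_on_SucD[OF S[of "snd y"] Su]) (use that in \<open>simp add: S_def\<close>)
  have dxu: "dx i u y = u' y (axis i 1)" if "y \<in> D" for y i
    by (rule dx_slice[OF u'[OF that]])
  have dxF: "dx i (\<lambda>y. F i (u y)) y = jacobian (F i) (at (u y)) *v dx i u y" if "y \<in> D" for i y
    unfolding dxu[OF that]
    using has_derivative_compose[OF u'[OF that], of "F i"] F_derivative(1)[OF u[OF that]]
    by (intro dx_slice) simp
  let ?b = "\<lambda>i y. dx i (\<lambda>y. B (u y)) y"
  have dxB: "?b i y = jacobian B (at (u y)) *v u' y (axis i 1)" if "y \<in> D" for i y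
    using has_derivative_compose[OF u'[OF that], of B] B_derivative[OF u[OF that]]
    by (intro dx_slice) simp
  define b' where "b' i = frechet_derivative (\<lambda>x. ?b i (x, snd z)) (at (fst z))" for i
  \<comment> \<open>On the spatial slice, \<open>?b i\<close> is the Jacobian of \<open>B\<close>
    along \<open>u\<close> times a first derivative of \<open>u\<close>; both factors are
    differentiable since \<open>u\<close> is twice differentiable in space, and the product rule
    applies.\<close>
  have b': "((\<lambda>x. ?b i (x, snd z)) has_derivative b' i) (at (fst z))" for i
  proof -
    let ?t = "snd z"
    have zS: "fst z \<in> S ?t" using z by (simp add: S_def)
    have "axis i 1 \<in> (Basis :: (real^'d) set)" by simp
    then have "Ck_on 1 (\<lambda>x. u' (x, ?t) (axis i 1)) (S ?t)"
      using Su[of ?t] unfolding u'_def fst_conv snd_conv Ck_on.simps(2)[of 1] by blast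
    then have 1: "(\<lambda>x. u' (x, ?t) (axis i 1)) differentiable (at (fst z))"
      by (rule Ck_on_differentiable[OF _ S zS])
    have "(\<lambda>v. jacobian B (at v)) differentiable (at (u z))"
      by (rule Ck_on_differentiable[OF Ck_on_jacobian[OF open_\<Omega>u Ck_on_B] open_\<Omega>u u[OF z]])
    moreover have "(\<lambda>x. u (x, ?t)) differentiable (at (fst z))"
      using u'[OF z] by (rule differentiableI)
    ultimately have 2: "(\<lambda>x. jacobian B (at (u (x, ?t)))) differentiable (at (fst z))"
      using differentiable_compose[of "\<lambda>v. jacobian B (at v)" "\<lambda>x. u (x, ?t)" "fst z" UNIV] by simp
    obtain g where "((\<lambda>x. jacobian B (at (u (x, ?t))) *v u' (x, ?t) (axis i 1)) has_derivative g) (at (fst z))"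
      using 1 2 bounded_bilinear.FDERIV[OF bounded_bilinear_matrix_vector_mult]
      unfolding differentiable_def by blast
    then have "((\<lambda>x. ?b i (x, ?t)) has_derivative g) (at (fst z))"
      by (rule has_derivative_transform_within_open[OF _ S zS]) (simp add: dxB S_def)
    then show ?thesis unfolding b'_def using frechet_derivative_at by metis
  qed
  have w1_lin: "bounded_linear (w1_map i)" for i
    by (intro linear_conv_bounded_linear[THEN iffD1] linearI)
      (simp_all add: w1_map_def vec_eq_iff algebra_simps)
  have "dx j (limit_w1 A kinetic_Q u) z = dx j (\<lambda>y. - (\<Sum>i\<in>UNIV. w1_map i (?b i y))) z" for j
    by (rule dx_cong[OF D z]) (simp add: limit_w1_kinetic u block21_w1_map dxu dxB)
  moreover have "dx j (\<lambda>y. - (\<Sum>i\<in>UNIV. w1_map i (?b i y))) z = - (\<Sum>i\<in>UNIV. w1_map i (b' i (axis j 1)))" for j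
    by (rule dx_slice) (intro has_derivative_minus has_derivative_sum bounded_linear.has_derivative[OF w1_lin] b')
  moreover have "dx j (?b j) z = b' j (axis j 1)" for j
    by (rule dx_slice[OF b'])
  ultimately show ?thesis
    unfolding limit_equation_kinetic[of u z, OF u[OF z]] parabolic_equation_def
    using block12_w1_map[OF u[OF z], of "\<lambda>i j. b' i (axis j 1)"]
    by (simp add: dxF[OF z] sum_negf linear_neg[OF matrix_vector_mul_linear] algebra_simps)
qed

theorem mainTheorem7:
  fixes \<Omega>u :: "(real^'k) set"
    and \<Omega> :: "(real^('k + 'r::finite \<times> 'k)) set"
    and F :: "'d::finite \<Rightarrow> real^'k \<Rightarrow> real^'k"
    and B :: "real^'k \<Rightarrow> real^'k"
    and M :: "nat \<Rightarrow> real^'k \<Rightarrow> real^'k"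
    and lam \<sigma> :: "nat \<Rightarrow> 'd \<Rightarrow> real"
    and \<mu> \<theta> :: real
    and N N' :: nat
    and e :: "'r \<Rightarrow> nat"
  defines "A \<equiv> kinetic_A N N' lam \<sigma> \<mu> \<theta> B M e"
    and "Q \<equiv> kinetic_Q"
  assumes spaces: "state_spaces \<Omega>u \<Omega>"
    and smooth_F: "\<And>j. smooth_on \<Omega>u (F j)"
    and smooth_B: "smooth_on \<Omega>u B"
    and smooth_M: "\<And>l. l \<in> {1..N} \<Longrightarrow> smooth_on \<Omega>u (M l)"
    and B1: "\<And>u \<xi>::real^'d. u \<in> \<Omega>u \<Longrightarrow>
          real_eigenvalues (\<Sum>j\<in>UNIV. \<xi> $ j *\<^sub>R jacobian (F j) (at u)) \<and>
          diagonalizable (\<Sum>j\<in>UNIV. \<xi> $ j *\<^sub>R jacobian (F j) (at u))"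
    and B2: "\<And>u. u \<in> \<Omega>u \<Longrightarrow> positive_eigenvalues (jacobian B (at u))"
    and N: "N \<ge> 1"
    and N': "N' \<ge> CARD('d) + 1"
    and e: "bij_betw e UNIV {2..N + N'}"
    and mu: "\<mu> \<ge> 0"
    and theta: "\<theta> > 0"
    and sigma_sum: "\<And>j. (\<Sum>m=1..N'. \<sigma> m j) = 0"
    and sigma_orth: "\<And>i j. (\<Sum>m=1..N'. \<sigma> m j * \<sigma> m i) = (if i = j then 1 else 0)"
    and M_sum: "\<And>u. u \<in> \<Omega>u \<Longrightarrow> (\<Sum>l=1..N. M l u) = u - (1 / \<theta>\<^sup>2) *\<^sub>R B u"
    and M_flux: "\<And>u j. u \<in> \<Omega>u \<Longrightarrow> (\<Sum>l=1..N. lam l j *\<^sub>R M l u) = F j u"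
    and C1: "\<And>u l. u \<in> \<Omega>u \<Longrightarrow> l \<in> {1..N} \<Longrightarrow> positive_eigenvalues (jacobian (M l) (at u))"
    and C2: "\<And>u \<xi>::real^'d. norm \<xi> = 1 \<Longrightarrow> u \<in> \<Omega>u \<Longrightarrow>
          common_eigenbasis
            ({\<Sum>j\<in>UNIV. \<xi> $ j *\<^sub>R jacobian (F j) (at u)}
             \<union> (\<lambda>l. jacobian (M l) (at u)) ` {1..N} \<union> {jacobian B (at u)})"
  shows
    "(\<forall>u\<in>\<Omega>u. invertible (kinetic_P N N' \<theta> B M e u)) \<and>
     (\<forall>\<epsilon> f z. 0 < \<epsilon> \<and> \<epsilon> \<le> 1 \<and> (\<forall>l\<in>{1..N + N'}. f l differentiable (at z)) \<and>
              (\<Sum>l=1..N + N'. f l z) \<in> \<Omega>u \<longrightarrow>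
        (kinetic_model N N' lam \<sigma> \<mu> \<theta> B M \<epsilon> f z \<longleftrightarrow>
         first_order_equation A Q \<epsilon> (\<lambda>y. kinetic_U N N' \<theta> B M e (\<lambda>l. f l y)) z)) \<and>
     convergence_criteria \<Omega>u \<Omega> A Q \<and>
     (\<forall>D u. open D \<and> u ` D \<subseteq> \<Omega>u \<and> C21_on D u \<longrightarrow>
        (\<forall>z\<in>D. limit_equation A Q u z \<longleftrightarrow> parabolic_equation F B u z))"
proof -
  have open_\<Omega>u: "open \<Omega>u" and \<Omega>': "\<And>u w. state u w \<in> \<Omega> \<Longrightarrow> u \<in> \<Omega>u"
    using spaces unfolding state_spaces_def by blast+
  interpret kinetic_system e N N' \<Omega>u F B M lam \<sigma> \<mu> \<theta>
    by unfold_locales (use open_\<Omega>u smooth_B smooth_M N N' e theta sigma_sum sigma_orth M_sum M_flux in auto)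
  have \<Omega>: "upart U \<in> \<Omega>u" if "U \<in> \<Omega>" for U
    using \<Omega>'[of "upart U" "wpart U"] that by simp
  \<comment> \<open>Any unit direction serves: the Jacobians of the \<open>M l\<close> and of
    \<open>B\<close>, from which the symmetrizer is built, do not involve
    \<open>\<xi>\<close>.\<close>
  obtain \<xi> :: "real^'d" where \<xi>: "norm \<xi> = 1"
    using norm_axis_1 by blast
  have "\<exists>D G. \<forall>l\<in>{1..N+N'}. sym_pos_def (D l) \<and> D l ** J u l = G" if "u \<in> \<Omega>u" for u
    by (rule block_symmetrizers[OF that B2[OF that] C1[OF that] C2[OF \<xi> that]]) auto
  \<comment> \<open>\<open>D\<close> and \<open>G\<close> are chosen separately at each
    \<open>u\<close>; criterion (iii) does not ask for smooth dependence.\<close>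
  then obtain D G where D: "\<And>u l. u \<in> \<Omega>u \<Longrightarrow> l \<in> {1..N+N'} \<Longrightarrow> sym_pos_def (D u l) \<and> D u l ** J u l = G u"
    by metis
  note symmetrizer_kinetic[OF D \<Omega>]
  then have "convergence_criteria \<Omega>u \<Omega> A Q"
    unfolding convergence_criteria_def A_def Q_def
    using spaces smooth_coefficients_kinetic[OF \<Omega>] criterion_i_kinetic criterion_ii_kinetic criterion_v_kinetic
    by blast
  moreover have "\<forall>u\<in>\<Omega>u. invertible (kinetic_P N N' \<theta> B M e u)"
    using invertible_kinetic_P by blast
  ultimately show ?thesis
    unfolding A_def Q_def
    using kinetic_model_first_order limit_equation_parabolic by blast
qed

end
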